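(* Let $k$ be a smooth function on $\mathbb{R}_+=(0,\infty)$ with $k(t)=O(t^\infty)$ such that the plane curve given in polar coordinates by $r(t)=t$, $\phi(t)=e^{1/t}$, $t\in(0,1]$, satisfies, with respect to the Euclidean metric $dr^2+r^2d\phi^2$ on $\mathbb{R}^2$, $$\nabla_{\vec v}\frac{\vec v\wedge\vec b}{|\vec v|^3}=k(t)\,\frac{\vec v\wedge\hat M\vec v}{|\vec v|}$$ (such a function exists), and put $h(r)=-\tfrac12 k(r)$. Consider the smooth Riemannian metric on $\mathbb{R}^3$ given in cylindrical coordinates $(x,y,z)=(r\cos\phi,r\sin\phi,z)$ by $$ds^2=\left(1+h(r)^2z^4\right)\left(dr^2+r^2d\phi^2\right)+4h(r)z^2\,r\,dr\,d\phi+dz^2 .$$ Then the curve $r(t)=t$, $\phi(t)=e^{1/t}$, $t\in(0,1]$, in the plane $z=0$, is a spiraling conformal geodesic of this metric after proper time reparametrization: it is a conformal geodesic, and it is a spiral converging to the origin (as $t\to 0_+$).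
   Context: For a function $f$ on $(0,\infty)$, $f(t)=O(t^\infty)$ means that $f$ is smooth and extends smoothly by zero to the negative numbers, i.e. $f$ and all its derivatives tend to $0$ as $t\to0_+$. At $r=0$ the metric is understood through its smooth extension, where it equals $dx^2+dy^2+dz^2$. Products such as $dr\,d\phi$ are symmetric products: $\alpha\beta=\frac12(\alpha\otimes\beta+\beta\otimes\alpha)$. On the Euclidean plane away from the origin, $M=2\,\check e_r\check e_\phi=2r\,dr\,d\phi$, where $\check e_r=dr$, $\check e_\phi=r\,d\phi$ is the orthonormal polar coframe. For a covariant 2-tensor $H$, $(\hat H\vec u)^\mu=H^{\mu\nu}u_\nu$ (indices raised and lowered with the metric). For a curve with parameter $t$, $\vec v$ is its velocity and $\vec b=\nabla_{\vec v}\vec v$; $\nabla$ is the Levi-Civita covariant derivative, $|\cdot|$ is the length of a vector, and $\wedge$ is the wedge product of vectors. Proper time parametrization means that the velocity has norm one. Here the proper time increases as $t$ decreases to $0$. Conformal geodesic (parametrized by proper time), in a Riemannian manifold of dimension $n\ge 3$: a curve with velocity $\vec u$, $|\vec u|^2=1$, and $\vec a=\nabla_{\vec u}\vec u$, satisfying $$\nabla_{\vec u}\vec a=\vec u\left(-|\vec a|^2-\vec u\cdot\hat L\vec u\right)+\hat L\vec u,$$ where $L$ is the Schouten tensor, $L_{\mu\nu}=\frac{1}{n-2}\left(R_{\mu\nu}-\frac{R}{2(n-1)}g_{\mu\nu}\right)$, with $R_{\mu\nu}$ the Ricci tensor and $R$ the scalar curvature of the metric $g$. Spiral to a point $p$: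 a curve $\mathbb{R}_+\ni s\mapsto\gamma(s)$ parametrized by proper time such that for every open neighbourhood $U$ of $p$ there is $s_0\in\mathbb{R}_+$ with $\gamma(s)\in U$ for all $s>s_0$.
   Formalization: The tensor ds² degenerates where |h(r)|z²=1, so it is not Riemannian on all of R³; it is shown smooth on R³ and a Riemannian metric on the open set |h(r)|z²≠1 (including the axis r=0), which contains the plane z=0 and the curve. *)

theory Defs
  imports "HOL-Analysis.Analysis"
begin

section \<open>Riemannian geometry on open subsets of Euclidean space\<close>

text \<open>
  Everything is written in the global Cartesian chart.  A covariant 2-tensor field, in particular
  a metric, is the matrix field of its components; vectors and bivectors are given by their
  contravariant components.
\<close>

definition partial :: "'n::finite \<Rightarrow> (real^'n \<Rightarrow> real) \<Rightarrow> real^'n \<Rightarrow> real" where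
  "partial i f p = frechet_derivative f (at p) (axis i 1)"

text \<open>On an open set, \<open>f\<close> is smooth iff all its iterated partial derivatives exist and are Frechet
  differentiable; the empty list gives \<open>f\<close> itself.\<close>

definition smooth_fun_on :: "(real^'n) set \<Rightarrow> (real^'n::finite \<Rightarrow> real) \<Rightarrow> bool" where
  "smooth_fun_on U f \<longleftrightarrow> (\<forall>is. foldr partial is f differentiable_on U)"

definition smooth_tensor_on :: "(real^'n) set \<Rightarrow> (real^'n::finite \<Rightarrow> real^'n^'n) \<Rightarrow> bool" where
  "smooth_tensor_on U H \<longleftrightarrow> (\<forall>i j. smooth_fun_on U (\<lambda>p. H p $ i $ j))"

definition riemannian_metric_on :: "(real^'n) set \<Rightarrow> (real^'n::finite \<Rightarrow> real^'n^'n) \<Rightarrow> bool" where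
  "riemannian_metric_on U g \<longleftrightarrow> open U \<and> smooth_tensor_on U g \<and>
     (\<forall>p\<in>U. transpose (g p) = g p \<and> (\<forall>u. u \<noteq> 0 \<longrightarrow> 0 < u \<bullet> (g p *v u)))"

definition ginner :: "(real^'n::finite \<Rightarrow> real^'n^'n) \<Rightarrow> real^'n \<Rightarrow> real^'n \<Rightarrow> real^'n \<Rightarrow> real" where
  "ginner g p u w = u \<bullet> (g p *v w)"

definition glength :: "(real^'n::finite \<Rightarrow> real^'n^'n) \<Rightarrow> real^'n \<Rightarrow> real^'n \<Rightarrow> real" where
  "glength g p u = sqrt (ginner g p u u)"

text \<open>\<open>hat g H p u\<close> has components \<open>H\<^sup>\<mu>\<^sup>\<nu> u\<^sub>\<nu> = g\<^sup>\<mu>\<^sup>\<alpha> H\<^sub>\<alpha>\<^sub>\<beta> u\<^sup>\<beta>\<close>.\<close>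

definition hat :: "(real^'n::finite \<Rightarrow> real^'n^'n) \<Rightarrow> (real^'n \<Rightarrow> real^'n^'n) \<Rightarrow> real^'n \<Rightarrow> real^'n \<Rightarrow> real^'n" where
  "hat g H p u = matrix_inv (g p) *v (H p *v u)"

text \<open>\<open>christoffel g k i j\<close> is \<open>\<Gamma>\<^sup>k\<^sub>i\<^sub>j\<close>.\<close>

definition christoffel :: "(real^'n::finite \<Rightarrow> real^'n^'n) \<Rightarrow> 'n \<Rightarrow> 'n \<Rightarrow> 'n \<Rightarrow> real^'n \<Rightarrow> real" where
  "christoffel g k i j p = (\<Sum>l\<in>UNIV. matrix_inv (g p) $ k $ l *
     (partial i (\<lambda>q. g q $ l $ j) p + partial j (\<lambda>q. g q $ l $ i) p - partial l (\<lambda>q. g q $ i $ j) p)) / 2"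

text \<open>\<open>riemann g l k i j\<close> is \<open>R\<^sup>l\<^sub>k\<^sub>i\<^sub>j\<close>, the \<open>l\<close>-th component of \<open>R(\<partial>\<^sub>i, \<partial>\<^sub>j) \<partial>\<^sub>k\<close>.  The Ricci tensor is
  \<open>R\<^sub>k\<^sub>j = R\<^sup>l\<^sub>k\<^sub>l\<^sub>j\<close>, which is positive on round spheres.\<close>

definition riemann :: "(real^'n::finite \<Rightarrow> real^'n^'n) \<Rightarrow> 'n \<Rightarrow> 'n \<Rightarrow> 'n \<Rightarrow> 'n \<Rightarrow> real^'n \<Rightarrow> real" where
  "riemann g l k i j p =
     partial i (christoffel g l j k) p - partial j (christoffel g l i k) p +
     (\<Sum>m\<in>UNIV. christoffel g l i m p * christoffel g m j k p -
                christoffel g l j m p * christoffel g m i k p)"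

definition ricci :: "(real^'n::finite \<Rightarrow> real^'n^'n) \<Rightarrow> real^'n \<Rightarrow> real^'n^'n" where
  "ricci g p = (\<chi> k j. \<Sum>l\<in>UNIV. riemann g l k l j p)"

definition scalar_curvature :: "(real^'n::finite \<Rightarrow> real^'n^'n) \<Rightarrow> real^'n \<Rightarrow> real" where
  "scalar_curvature g p = (\<Sum>i\<in>UNIV. \<Sum>j\<in>UNIV. matrix_inv (g p) $ i $ j * ricci g p $ i $ j)"

definition schouten :: "(real^'n::finite \<Rightarrow> real^'n^'n) \<Rightarrow> real^'n \<Rightarrow> real^'n^'n" where
  "schouten g p = (1 / (real CARD('n) - 2)) *\<^sub>R
     (ricci g p - (scalar_curvature g p / (2 * (real CARD('n) - 1))) *\<^sub>R g p)"

section \<open>Curves\<close>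

text \<open>All derivatives along a curve are taken within its parameter interval \<open>I\<close>, so they are
  one-sided at an endpoint belonging to \<open>I\<close>.\<close>

definition velocity :: "real set \<Rightarrow> (real \<Rightarrow> 'a::real_normed_vector) \<Rightarrow> real \<Rightarrow> 'a" where
  "velocity I \<gamma> s = vector_derivative \<gamma> (at s within I)"

definition smooth_curve_on :: "real set \<Rightarrow> (real \<Rightarrow> 'a::real_normed_vector) \<Rightarrow> bool" where
  "smooth_curve_on I \<gamma> \<longleftrightarrow> (\<forall>m. (velocity I ^^ m) \<gamma> differentiable_on I)"

text \<open>Covariant derivatives, along \<open>\<gamma>\<close> and in the direction of its velocity, of a vector field \<open>X\<close>
  and of a bivector field \<open>B\<close> along \<open>\<gamma>\<close>.\<close>

definition cov_deriv ::
  "(real^'n::finite \<Rightarrow> real^'n^'n) \<Rightarrow> real set \<Rightarrow> (real \<Rightarrow> real^'n) \<Rightarrow> (real \<Rightarrow> real^'n) \<Rightarrow> real \<Rightarrow> real^'n" where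
  "cov_deriv g I \<gamma> X s = vector_derivative X (at s within I) +
     (\<chi> k. \<Sum>i\<in>UNIV. \<Sum>j\<in>UNIV. christoffel g k i j (\<gamma> s) * velocity I \<gamma> s $ i * X s $ j)"

definition cov_deriv_biv ::
  "(real^'n::finite \<Rightarrow> real^'n^'n) \<Rightarrow> real set \<Rightarrow> (real \<Rightarrow> real^'n) \<Rightarrow> (real \<Rightarrow> real^'n^'n) \<Rightarrow> real \<Rightarrow> real^'n^'n" where
  "cov_deriv_biv g I \<gamma> B s = vector_derivative B (at s within I) +
     (\<chi> k l. \<Sum>i\<in>UNIV. \<Sum>j\<in>UNIV. velocity I \<gamma> s $ i *
        (christoffel g k i j (\<gamma> s) * B s $ j $ l + christoffel g l i j (\<gamma> s) * B s $ k $ j))"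

text \<open>Bivectors are antisymmetric matrices, \<open>u \<and> w = u \<otimes> w - w \<otimes> u\<close>; a different normalisation
  would rescale both sides of the equation in \<open>spiral_profile\<close> below alike.\<close>

definition wedge :: "real^'n::finite \<Rightarrow> real^'n \<Rightarrow> real^'n^'n" where
  "wedge u w = (\<chi> i j. u $ i * w $ j - w $ i * u $ j)"

definition acceleration ::
  "(real^'n::finite \<Rightarrow> real^'n^'n) \<Rightarrow> real set \<Rightarrow> (real \<Rightarrow> real^'n) \<Rightarrow> real \<Rightarrow> real^'n" where
  "acceleration g I \<gamma> = cov_deriv g I \<gamma> (velocity I \<gamma>)"

definition proper_time_parametrized ::
  "(real^'n::finite \<Rightarrow> real^'n^'n) \<Rightarrow> real set \<Rightarrow> (real \<Rightarrow> real^'n) \<Rightarrow> bool" where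
  "proper_time_parametrized g I \<gamma> \<longleftrightarrow> smooth_curve_on I \<gamma> \<and>
     (\<forall>s\<in>I. glength g (\<gamma> s) (velocity I \<gamma> s) = 1)"

definition conformal_geodesic ::
  "(real^'n) set \<Rightarrow> (real^'n::finite \<Rightarrow> real^'n^'n) \<Rightarrow> real set \<Rightarrow> (real \<Rightarrow> real^'n) \<Rightarrow> bool" where
  "conformal_geodesic U g I \<gamma> \<longleftrightarrow>
     3 \<le> CARD('n) \<and> riemannian_metric_on U g \<and>
     is_interval I \<and> interior I \<noteq> {} \<and> \<gamma> ` I \<subseteq> U \<and>
     proper_time_parametrized g I \<gamma> \<and>
     (\<forall>s\<in>I. let p = \<gamma> s; u = velocity I \<gamma> s; a = acceleration g I \<gamma>; Lu = hat g (schouten g) p u in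
        cov_deriv g I \<gamma> a s =
          (- (glength g p (a s))\<^sup>2 - ginner g p u Lu) *\<^sub>R u + Lu)"

definition spirals_to ::
  "(real^'n::finite \<Rightarrow> real^'n^'n) \<Rightarrow> (real \<Rightarrow> real^'n) \<Rightarrow> real^'n \<Rightarrow> bool" where
  "spirals_to g \<gamma> p \<longleftrightarrow> proper_time_parametrized g {0<..} \<gamma> \<and>
     (\<forall>V. open V \<and> p \<in> V \<longrightarrow> (\<exists>s0>0. \<forall>s>s0. \<gamma> s \<in> V))"

section \<open>The profile function and the metric\<close>

text \<open>\<open>f = O(t\<^sup>\<infinity>)\<close> for a function on the positive half-line; its values elsewhere are irrelevant.\<close>

definition O_infty :: "(real \<Rightarrow> real) \<Rightarrow> bool" where
  "O_infty f \<longleftrightarrow> (\<forall>m. \<forall>t>0. (deriv ^^ m) f differentiable (at t)) \<and>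
     (\<forall>m. ((deriv ^^ m) f \<longlongrightarrow> 0) (at_right 0))"

definition symprod :: "real^'n::finite \<Rightarrow> real^'n \<Rightarrow> real^'n^'n" where
  "symprod \<alpha> \<beta> = (\<chi> i j. (\<alpha> $ i * \<beta> $ j + \<beta> $ i * \<alpha> $ j) / 2)"

text \<open>The forms \<open>dr\<close> and \<open>d\<phi>\<close> on the plane, in Cartesian components.\<close>

definition plane_dr :: "real^2 \<Rightarrow> real^2" where
  "plane_dr p = vector [p$1 / norm p, p$2 / norm p]"

definition plane_dphi :: "real^2 \<Rightarrow> real^2" where
  "plane_dphi p = vector [- p$2 / (norm p)\<^sup>2, p$1 / (norm p)\<^sup>2]"

definition tensor_M :: "real^2 \<Rightarrow> real^2^2" where
  "tensor_M p = (2 * norm p) *\<^sub>R symprod (plane_dr p) (plane_dphi p)"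

text \<open>The metric \<open>dr\<^sup>2 + r\<^sup>2 d\<phi>\<^sup>2\<close> in Cartesian components.\<close>

definition plane_metric :: "real^2 \<Rightarrow> real^2^2" where
  "plane_metric p = mat 1"

definition plane_spiral :: "real \<Rightarrow> real^2" where
  "plane_spiral t = vector [t * cos (exp (1/t)), t * sin (exp (1/t))]"

definition spiral_profile :: "(real \<Rightarrow> real) \<Rightarrow> bool" where
  "spiral_profile k \<longleftrightarrow> O_infty k \<and>
     (let I = {0<..1}; c = plane_spiral; g = plane_metric;
          v = velocity I c; b = cov_deriv g I c v
      in \<forall>t\<in>I. cov_deriv_biv g I c (\<lambda>s. (1 / glength g (c s) (v s) ^ 3) *\<^sub>R wedge (v s) (b s)) t =
           (k t / glength g (c t) (v t)) *\<^sub>R wedge (v t) (hat g tensor_M (c t) (v t)))"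

definition cyl_radius :: "real^3 \<Rightarrow> real" where
  "cyl_radius p = sqrt ((p$1)\<^sup>2 + (p$2)\<^sup>2)"

definition cyl_dr :: "real^3 \<Rightarrow> real^3" where
  "cyl_dr p = vector [p$1 / cyl_radius p, p$2 / cyl_radius p, 0]"

definition cyl_dphi :: "real^3 \<Rightarrow> real^3" where
  "cyl_dphi p = vector [- p$2 / (cyl_radius p)\<^sup>2, p$1 / (cyl_radius p)\<^sup>2, 0]"

definition cyl_dz :: "real^3" where
  "cyl_dz = vector [0, 0, 1]"

definition cyl_metric :: "(real \<Rightarrow> real) \<Rightarrow> real^3 \<Rightarrow> real^3^3" where
  "cyl_metric h p = (let r = cyl_radius p; z = p$3 in
     if r = 0 then mat 1
     else (1 + (h r)\<^sup>2 * z^4) *\<^sub>R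
            (symprod (cyl_dr p) (cyl_dr p) + r\<^sup>2 *\<^sub>R symprod (cyl_dphi p) (cyl_dphi p))
          + (4 * h r * z\<^sup>2 * r) *\<^sub>R symprod (cyl_dr p) (cyl_dphi p)
          + symprod cyl_dz cyl_dz)"

text \<open>In the orthonormal frame the planar block of \<open>cyl_metric h\<close> has eigenvalues
  \<open>(1 + h z\<^sup>2)\<^sup>2\<close> and \<open>(1 - h z\<^sup>2)\<^sup>2\<close>.  The tensor is therefore positive semidefinite everywhere, but
  it degenerates where \<open>\<bar>h\<bar> z\<^sup>2 = 1\<close>; it is a metric exactly on the following set, which is a
  neighbourhood of the plane \<open>z = 0\<close>.\<close>

definition cyl_domain :: "(real \<Rightarrow> real) \<Rightarrow> (real^3) set" where
  "cyl_domain h = {p. cyl_radius p = 0 \<or> \<bar>h (cyl_radius p)\<bar> * (p$3)\<^sup>2 \<noteq> 1}"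

definition space_spiral :: "real \<Rightarrow> real^3" where
  "space_spiral t = vector [t * cos (exp (1/t)), t * sin (exp (1/t)), 0]"

end

theory Submission
  imports Defs
begin

text \<open>
  With \<open>N\<close> the trace-free symmetric matrix of \<open>M\<close>, \<open>N\<^sup>2 = 1\<close>, the planar block of the metric is
  \<open>(1 + h z\<^sup>2 N)\<^sup>2\<close>.  It agrees with the Euclidean metric to first order along \<open>z = 0\<close>, so the Christoffel
  symbols vanish there, and the only second derivatives of the metric that survive are
  \<open>\<partial>\<^sub>z\<partial>\<^sub>z g = 4 h N\<close>.  Hence on this plane the Ricci tensor is \<open>- 2 h N = k N\<close>, the scalar curvature vanishes
  and the Schouten tensor is \<open>k N\<close>.  For a unit speed curve in the plane the tangential part of the conformal
  geodesic equation is automatic, and its normal part says that the derivative of the Euclidean curvature is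
  \<open>k u \<and> M u\<close>; this is the equation that defines \<open>k\<close>.

  The curvature of the spiral and its derivatives grow at most polynomially as \<open>t \<rightarrow> 0\<close>, whereas
  \<open>\<bar>v\<bar> \<ge> exp (1/t) / t\<close>, so solving for \<open>k\<close> gives a function that is flat at \<open>0\<close>.  The divergence of
  \<open>\<integral> \<bar>v\<bar> dt\<close> at \<open>0\<close> makes proper time range over a half-line.
\<close>

section \<open>Iterated derivatives on an interval with growth conditions at the origin\<close>

text \<open>\<open>P\<close> is instantiated with three conditions: none (class \<open>C\<^sup>m\<close>), at most polynomial growth at \<open>0\<close>, and
  decay at \<open>0\<close> faster than every power.\<close>

primrec tower :: "((real \<Rightarrow> real) \<Rightarrow> bool) \<Rightarrow> real set \<Rightarrow> nat \<Rightarrow> (real \<Rightarrow> real) \<Rightarrow> bool" where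
  "tower P A 0 f \<longleftrightarrow> P f"
| "tower P A (Suc m) f \<longleftrightarrow> P f \<and>
     (\<exists>f'. (\<forall>t\<in>A. (f has_real_derivative f' t) (at t within A)) \<and> tower P A m f')"

lemma tower_base: "tower P A m f \<Longrightarrow> P f"
  by (cases m) auto

lemma tower_SucD: "tower P A (Suc m) f \<Longrightarrow> tower P A m f"
  by (induction m arbitrary: f) auto

lemma tower_SucI:
  assumes "P f" "\<And>t. t \<in> A \<Longrightarrow> (f has_real_derivative f' t) (at t within A)" "tower P A m f'"
  shows "tower P A (Suc m) f"
  using assms by auto

lemma tower_SucE:
  assumes "tower P A (Suc m) f"
  obtains f' where "\<forall>t\<in>A. (f has_real_derivative f' t) (at t within A)" "tower P A m f'"
  using assms by auto

lemma tower_weaken: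
  assumes "tower P A m f" "\<And>g. P g \<Longrightarrow> Q g"
  shows "tower Q A m f"
  using assms(1)
proof (induction m arbitrary: f)
  case (Suc m)
  then show ?case using assms(2) by auto
qed (use assms(2) in auto)

lemma tower_subset: "tower P A m f \<Longrightarrow> B \<subseteq> A \<Longrightarrow> tower P B m f"
proof (induction m arbitrary: f)
  case (Suc m)
  obtain f' where f': "\<forall>t\<in>A. (f has_real_derivative f' t) (at t within A)" "tower P A m f'"
    by (rule tower_SucE[OF Suc.prems(1)])
  note f' = f'(1)[rule_format] f'(2)
  show ?case
  proof (rule tower_SucI)
    show "P f" using Suc.prems(1) by (rule tower_base)
    show "tower P B m f'" using Suc.IH f'(2) Suc.prems(2) by blast
  qed (use f'(1) Suc.prems(2) in \<open>auto intro: DERIV_subset\<close>)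
qed auto

lemma has_real_derivative_cong_on:
  assumes "\<And>t. t \<in> A \<Longrightarrow> f t = g t" "t \<in> A" "(f has_real_derivative d) (at t within A)"
  shows "(g has_real_derivative d) (at t within A)"
  by (rule has_field_derivative_transform_within[OF assms(3), of 1]) (use assms in auto)

text \<open>Agreement on \<open>A\<close> preserves derivatives within \<open>A\<close>, so the
  witness \<open>f'\<close> is kept. The condition \<open>P\<close> speaks of the whole function,
  hence its invariance is a separate hypothesis.\<close>

lemma tower_cong:
  assumes "tower P A m f" "\<And>t. t \<in> A \<Longrightarrow> f t = g t"
    and "\<And>f g. P f \<Longrightarrow> (\<And>t. t \<in> A \<Longrightarrow> f t = g t) \<Longrightarrow> P g"
  shows "tower P A m g"
proof (cases m)
  case 0
  with assms show ?thesis by auto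
next
  case (Suc n)
  then have "P f" using assms(1) by auto
  obtain f' where f': "\<forall>t\<in>A. (f has_real_derivative f' t) (at t within A)" "tower P A n f'"
    using assms(1) unfolding Suc by (rule tower_SucE)
  have "P g" by (rule assms(3)[OF \<open>P f\<close> assms(2)])
  moreover have "\<forall>t\<in>A. (g has_real_derivative f' t) (at t within A)"
    by (intro ballI has_real_derivative_cong_on[OF assms(2)]) (use f'(1) in auto)
  ultimately show ?thesis using f'(2) Suc by auto
qed

lemma tower_add:
  assumes "\<And>f g. P f \<Longrightarrow> P g \<Longrightarrow> P (\<lambda>t. f t + g t)"
    and "tower P A m f" "tower P A m g"
  shows "tower P A m (\<lambda>t. f t + g t)"
  using assms(2,3)
proof (induction m arbitrary: f g)
  case (Suc m)
  obtain f' where f': "\<forall>t\<in>A. (f has_real_derivative f' t) (at t within A)" "tower P A m f'"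
    by (rule tower_SucE[OF Suc.prems(1)])
  note f' = f'(1)[rule_format] f'(2)
  obtain g' where g': "\<forall>t\<in>A. (g has_real_derivative g' t) (at t within A)" "tower P A m g'"
    by (rule tower_SucE[OF Suc.prems(2)])
  note g' = g'(1)[rule_format] g'(2)
  note * = f' g'
  show ?case
  proof (rule tower_SucI)
    show "P (\<lambda>t. f t + g t)" by (rule assms(1)[OF tower_base[OF Suc.prems(1)] tower_base[OF Suc.prems(2)]])
    show "tower P A m (\<lambda>t. f' t + g' t)" by (rule Suc.IH[OF *(2,4)])
    show "((\<lambda>t. f t + g t) has_real_derivative f' t + g' t) (at t within A)" if "t \<in> A" for t
      by (rule DERIV_add[OF *(1)[OF that] *(3)[OF that]])
  qed
qed (simp add: assms(1))

text \<open>The Leibniz rule with three classes at once, which covers products inside one class as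
  well as flat times moderate is flat.\<close>

lemma tower_mult_general:
  assumes PQ: "\<And>f g. P f \<Longrightarrow> Q g \<Longrightarrow> R (\<lambda>t. f t * g t)"
    and R: "\<And>f g. R f \<Longrightarrow> R g \<Longrightarrow> R (\<lambda>t. f t + g t)"
    and "tower P A m f" "tower Q A m g"
  shows "tower R A m (\<lambda>t. f t * g t)"
  using assms(3,4)
proof (induction m arbitrary: f g)
  case (Suc m)
  obtain f' where f': "\<forall>t\<in>A. (f has_real_derivative f' t) (at t within A)" "tower P A m f'"
    by (rule tower_SucE[OF Suc.prems(1)])
  note f' = f'(1)[rule_format] f'(2)
  obtain g' where g': "\<forall>t\<in>A. (g has_real_derivative g' t) (at t within A)" "tower Q A m g'"
    by (rule tower_SucE[OF Suc.prems(2)])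
  note g' = g'(1)[rule_format] g'(2)
  note * = f' g'
  show ?case
  proof (rule tower_SucI)
    show "R (\<lambda>t. f t * g t)" by (rule PQ[OF tower_base[OF Suc.prems(1)] tower_base[OF Suc.prems(2)]])
    show "tower R A m (\<lambda>t. f' t * g t + f t * g' t)"
      by (intro tower_add R Suc.IH *(2,4) tower_SucD[OF Suc.prems(1)] tower_SucD[OF Suc.prems(2)])
    show "((\<lambda>t. f t * g t) has_real_derivative f' t * g t + f t * g' t) (at t within A)"
      if "t \<in> A" for t
      using DERIV_mult[OF *(1)[OF that] *(3)[OF that]] by (simp add: algebra_simps)
  qed
qed (simp add: PQ)

text \<open>The smooth and the moderate functions are instances. The flat functions are not, since
  they contain no nonzero constants; they only form an ideal over the moderate ones.\<close>

locale function_algebra =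
  fixes P :: "(real \<Rightarrow> real) \<Rightarrow> bool"
  assumes const: "P (\<lambda>_. c)"
    and add: "P f \<Longrightarrow> P g \<Longrightarrow> P (\<lambda>t. f t + g t)"
    and mult: "P f \<Longrightarrow> P g \<Longrightarrow> P (\<lambda>t. f t * g t)"
begin

lemma tower_const: "tower P A m (\<lambda>_. c)"
proof (induction m arbitrary: c)
  case (Suc m)
  show ?case
    by (rule tower_SucI[OF const _ Suc]) (rule DERIV_const)
qed (simp add: const)

lemma tower_plus: "tower P A m f \<Longrightarrow> tower P A m g \<Longrightarrow> tower P A m (\<lambda>t. f t + g t)"
  by (rule tower_add[where P = P]) (rule add, assumption+)

lemma tower_mult: "tower P A m f \<Longrightarrow> tower P A m g \<Longrightarrow> tower P A m (\<lambda>t. f t * g t)"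
  by (rule tower_mult_general[where P = P and Q = P and R = P])
    (rule mult, assumption, assumption, rule add, assumption+)

lemma tower_minus: "tower P A m f \<Longrightarrow> tower P A m (\<lambda>t. - f t)"
  using tower_mult[OF tower_const[of A m "-1"], of f] by simp

lemma tower_diff: "tower P A m f \<Longrightarrow> tower P A m g \<Longrightarrow> tower P A m (\<lambda>t. f t - g t)"
  using tower_plus[OF _ tower_minus, of A m f g] by simp

lemma tower_power: "tower P A m f \<Longrightarrow> tower P A m (\<lambda>t. f t ^ n)"
  by (induction n) (auto intro: tower_const tower_mult)

lemma tower_ident: "P (\<lambda>t. t) \<Longrightarrow> tower P A m (\<lambda>t. t)"
proof (cases m)
  case (Suc n)
  assume "P (\<lambda>t. t)"
  then show ?thesis unfolding Suc by (rule tower_SucI) (rule DERIV_ident, rule tower_const)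
qed simp

text \<open>The derivative is a polynomial in \<open>f'\<close> and the inverse itself, so the
  growth of the inverse has to be controlled only at order 0.\<close>

lemma tower_inverse:
  assumes "tower P A m f" "P (\<lambda>t. inverse (f t))" "\<And>t. t \<in> A \<Longrightarrow> f t \<noteq> 0"
  shows "tower P A m (\<lambda>t. inverse (f t))"
  using assms(1)
proof (induction m)
  case (Suc m)
  obtain f' where *: "\<forall>t\<in>A. (f has_real_derivative f' t) (at t within A)" "tower P A m f'"
    by (rule tower_SucE[OF Suc.prems])
  note * = *(1)[rule_format] *(2)
  have i: "tower P A m (\<lambda>t. inverse (f t))" by (rule Suc.IH[OF tower_SucD[OF Suc.prems]])
  show ?case
  proof (rule tower_SucI)
    show "tower P A m (\<lambda>t. - (inverse (f t) * f' t * inverse (f t)))"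
      by (intro tower_minus tower_mult i *)
    show "((\<lambda>t. inverse (f t)) has_real_derivative - (inverse (f t) * f' t * inverse (f t))) (at t within A)"
      if "t \<in> A" for t
      by (rule DERIV_inverse'[OF *(1)[OF that] assms(3)[OF that]])
  qed (rule assms(2))
qed (simp add: assms(2))

text \<open>Writing the derivative as \<open>f'\<close> times \<open>sqrt f * inverse f\<close>, up
  to the factor 1/2, makes the square root reappear in its own derivative, which closes the
  induction.\<close>

lemma tower_sqrt:
  assumes "tower P A m f" "P (\<lambda>t. sqrt (f t))" "P (\<lambda>t. inverse (f t))" "\<And>t. t \<in> A \<Longrightarrow> f t > 0"
  shows "tower P A m (\<lambda>t. sqrt (f t))"
  using assms(1)
proof (induction m)
  case (Suc m)
  obtain f' where *: "\<forall>t\<in>A. (f has_real_derivative f' t) (at t within A)" "tower P A m f'"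
    by (rule tower_SucE[OF Suc.prems])
  note * = *(1)[rule_format] *(2)
  have i: "tower P A m (\<lambda>t. sqrt (f t))" by (rule Suc.IH[OF tower_SucD[OF Suc.prems]])
  have j: "tower P A m (\<lambda>t. inverse (f t))"
    by (rule tower_inverse[OF tower_SucD[OF Suc.prems] assms(3)]) (metis assms(4) less_irrefl)
  show ?case
  proof (rule tower_SucI)
    show "tower P A m (\<lambda>t. (1/2) * f' t * (sqrt (f t) * inverse (f t)))"
      by (intro tower_mult tower_const i j *)
    show "((\<lambda>t. sqrt (f t)) has_real_derivative (1/2) * f' t * (sqrt (f t) * inverse (f t))) (at t within A)"
      if "t \<in> A" for t
    proof -
      have "sqrt (f t) * inverse (f t) = inverse (sqrt (f t))"
        using assms(4)[OF that] by (simp add: field_simps)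
      moreover have "((\<lambda>t. sqrt (f t)) has_real_derivative inverse (sqrt (f t)) / 2 * f' t) (at t within A)"
        using DERIV_chain2[OF DERIV_real_sqrt *(1)[OF that]] assms(4)[OF that] by auto
      ultimately show ?thesis by (simp add: mult_ac)
    qed
  qed (rule assms(2))
qed (simp add: assms(2))

end

section \<open>Smooth functions of one variable\<close>

abbreviation smooth_upto :: "real set \<Rightarrow> nat \<Rightarrow> (real \<Rightarrow> real) \<Rightarrow> bool" where
  "smooth_upto \<equiv> tower (\<lambda>_. True)"

interpretation smooth: function_algebra "\<lambda>_. True"
  by standard auto

lemma smooth_cong:
  assumes "smooth_upto A m f" "\<And>t. t \<in> A \<Longrightarrow> f t = g t"
  shows "smooth_upto A m g"
  using tower_cong[OF assms] by auto

lemma smooth_compose: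
  assumes "smooth_upto B m f" "smooth_upto A m g" "g ` A \<subseteq> B"
  shows "smooth_upto A m (\<lambda>t. f (g t))"
  using assms
proof (induction m arbitrary: f)
  case (Suc m)
  obtain f' where f': "\<forall>t\<in>B. (f has_real_derivative f' t) (at t within B)" "smooth_upto B m f'"
    by (rule tower_SucE[OF Suc.prems(1)])
  note f' = f'(1)[rule_format] f'(2)
  obtain g' where g': "\<forall>t\<in>A. (g has_real_derivative g' t) (at t within A)" "smooth_upto A m g'"
    by (rule tower_SucE[OF Suc.prems(2)])
  note g' = g'(1)[rule_format] g'(2)
  note * = f' g'
  show ?case
  proof (rule tower_SucI)
    show "smooth_upto A m (\<lambda>t. f' (g t) * g' t)"
      by (intro smooth.tower_mult Suc.IH[OF *(2)] *(4) tower_SucD[OF Suc.prems(2)] Suc.prems(3))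
    show "((\<lambda>t. f (g t)) has_real_derivative f' (g t) * g' t) (at t within A)" if "t \<in> A" for t
    proof -
      have "(f has_real_derivative f' (g t)) (at (g t) within g ` A)"
        using *(1)[of "g t"] that Suc.prems(3) by (auto intro: DERIV_subset)
      from DERIV_image_chain[OF this *(3)[OF that]] show ?thesis by (simp add: o_def)
    qed
  qed auto
qed auto

lemma smooth_exp: "smooth_upto A m (\<lambda>t. exp t)"
proof (induction m)
  case (Suc m)
  then show ?case by (intro tower_SucI[where f' = exp]) (auto intro: DERIV_exp DERIV_subset)
qed auto

lemma smooth_sin_cos: "smooth_upto A m (\<lambda>t. sin t) \<and> smooth_upto A m (\<lambda>t. cos t)"
proof (induction m)
  case (Suc m)
  have "smooth_upto A (Suc m) (\<lambda>t. sin t)"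
    using Suc by (intro tower_SucI[where f' = cos]) (auto intro: DERIV_sin DERIV_subset)
  moreover have "smooth_upto A (Suc m) (\<lambda>t. cos t)"
    using Suc smooth.tower_minus
    by (intro tower_SucI[where f' = "\<lambda>t. - sin t"]) (auto intro: DERIV_cos DERIV_subset)
  ultimately show ?case by blast
qed auto

section \<open>Polynomial growth and flatness at the origin\<close>

definition moderate :: "(real \<Rightarrow> real) \<Rightarrow> bool" where
  "moderate f \<longleftrightarrow> (\<exists>n C. \<forall>\<^sub>F t in at_right 0. \<bar>f t\<bar> * t ^ n \<le> C)"

definition flat :: "(real \<Rightarrow> real) \<Rightarrow> bool" where
  "flat f \<longleftrightarrow> (\<forall>n. ((\<lambda>t. f t / t ^ n) \<longlongrightarrow> 0) (at_right 0))"

lemma eventually_at_right_01: "\<forall>\<^sub>F t in at_right (0::real). 0 < t \<and> t < 1"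
  using eventually_at_right_real[of 0 "1::real"] by simp

lemma moderateI:
  assumes "\<forall>\<^sub>F t in at_right 0. \<bar>f t\<bar> \<le> C"
  shows "moderate f"
  unfolding moderate_def by (rule exI[of _ 0], rule exI[of _ C]) (use assms in simp)

lemma moderate_bound_nonneg:
  assumes "moderate f"
  obtains n C where "C \<ge> 0" "\<forall>\<^sub>F t in at_right 0. \<bar>f t\<bar> * t ^ n \<le> C"
proof -
  from assms obtain n C where *: "\<forall>\<^sub>F t in at_right 0. \<bar>f t\<bar> * t ^ n \<le> C"
    unfolding moderate_def by blast
  show ?thesis
    by (rule that[of "max C 0" n]) (use * in \<open>auto elim: eventually_mono\<close>)
qed

interpretation moderate: function_algebra moderate
proof
  show "moderate (\<lambda>_. c)" for c
    by (rule moderateI[of _ "\<bar>c\<bar>"]) simp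
next
  fix f g assume "moderate f" "moderate g"
  obtain n C where f: "C \<ge> 0" "\<forall>\<^sub>F t in at_right 0. \<bar>f t\<bar> * t ^ n \<le> C"
    using moderate_bound_nonneg[OF \<open>moderate f\<close>] .
  obtain k D where g: "D \<ge> 0" "\<forall>\<^sub>F t in at_right 0. \<bar>g t\<bar> * t ^ k \<le> D"
    using moderate_bound_nonneg[OF \<open>moderate g\<close>] .
  have "\<forall>\<^sub>F t in at_right 0. \<bar>f t + g t\<bar> * t ^ (n + k) \<le> C + D"
    using f(2) g(2) eventually_at_right_01
  proof eventually_elim
    case (elim t)
    then have "t ^ n \<le> 1" "t ^ k \<le> 1" by (auto intro: power_le_one)
    \<comment> \<open>Each summand keeps its own exponent; the surplus power of \<open>t\<close> is
      at most 1 on \<open>(0, 1)\<close>.\<close>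
    have "\<bar>f t + g t\<bar> * t ^ (n + k) \<le> (\<bar>f t\<bar> * t ^ n) * t ^ k + (\<bar>g t\<bar> * t ^ k) * t ^ n"
      using mult_right_mono[OF abs_triangle_ineq, of "t ^ (n + k)" "f t" "g t"] elim
      by (simp add: power_add algebra_simps)
    also have "\<dots> \<le> C * 1 + D * 1"
      using elim f(1) g(1) \<open>t ^ n \<le> 1\<close> \<open>t ^ k \<le> 1\<close> by (intro add_mono mult_mono) auto
    finally show ?case by simp
  qed
  then show "moderate (\<lambda>t. f t + g t)" unfolding moderate_def by blast
  have "\<forall>\<^sub>F t in at_right 0. \<bar>f t * g t\<bar> * t ^ (n + k) \<le> C * D"
    using f(2) g(2) eventually_at_right_01
  proof eventually_elim
    case (elim t)
    have "\<bar>f t * g t\<bar> * t ^ (n + k) = (\<bar>f t\<bar> * t ^ n) * (\<bar>g t\<bar> * t ^ k)"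
      by (simp add: power_add abs_mult)
    also have "\<dots> \<le> C * D"
      using elim f(1) g(1) by (intro mult_mono) auto
    finally show ?case .
  qed
  then show "moderate (\<lambda>t. f t * g t)" unfolding moderate_def by blast
qed

lemma flat_add: "flat f \<Longrightarrow> flat g \<Longrightarrow> flat (\<lambda>t. f t + g t)"
  unfolding flat_def using tendsto_add[where a = "0::real" and b = "0::real"]
  by (fastforce simp: add_divide_distrib)

text \<open>The \<open>k\<close> powers lost to \<open>g\<close> are taken from \<open>f\<close>,
  which decays to order \<open>n + k\<close> as well.\<close>

lemma flat_mult_moderate:
  assumes "flat f" "moderate g"
  shows "flat (\<lambda>t. f t * g t)"
  unfolding flat_def
proof
  fix n
  obtain k C where g: "C \<ge> 0" "\<forall>\<^sub>F t in at_right 0. \<bar>g t\<bar> * t ^ k \<le> C"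
    using moderate_bound_nonneg[OF assms(2)] .
  have "((\<lambda>t. f t / t ^ (n + k)) \<longlongrightarrow> 0) (at_right 0)"
    using assms(1) unfolding flat_def by blast
  then have lim: "((\<lambda>t. \<bar>f t / t ^ (n + k)\<bar> * C) \<longlongrightarrow> 0) (at_right 0)"
    by (intro tendsto_mult_left_zero tendsto_rabs_zero)
  show "((\<lambda>t. f t * g t / t ^ n) \<longlongrightarrow> 0) (at_right 0)"
  proof (rule Lim_null_comparison[OF _ lim])
    show "\<forall>\<^sub>F t in at_right 0. norm (f t * g t / t ^ n) \<le> \<bar>f t / t ^ (n + k)\<bar> * C"
      using g(2) eventually_at_right_01
    proof eventually_elim
      case (elim t)
      have "norm (f t * g t / t ^ n) = \<bar>f t / t ^ (n + k)\<bar> * (\<bar>g t\<bar> * t ^ k)"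
        using elim by (simp add: power_add abs_mult)
      also have "\<dots> \<le> \<bar>f t / t ^ (n + k)\<bar> * C"
        using elim by (intro mult_left_mono) auto
      finally show ?case .
    qed
  qed
qed

lemma flat_imp_moderate: "flat f \<Longrightarrow> moderate f"
proof -
  assume "flat f"
  then have "((\<lambda>t. f t / t ^ 0) \<longlongrightarrow> 0) (at_right 0)" unfolding flat_def by blast
  then have "\<forall>\<^sub>F t in at_right 0. \<bar>f t\<bar> < 1"
    using tendstoD[of f 0 "at_right 0" 1] by (simp add: dist_real_def)
  then show ?thesis by (intro moderateI[of _ 1]) (auto elim: eventually_mono)
qed

lemma moderate_ident: "moderate (\<lambda>t. t)"
  by (rule moderateI[of _ 1]) (use eventually_at_right_01 in \<open>auto elim: eventually_mono\<close>)

lemma moderate_inverse: "moderate (\<lambda>t. inverse t)"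
  unfolding moderate_def
  by (rule exI[of _ 1], rule exI[of _ 1]) (use eventually_at_right_01 in \<open>auto elim: eventually_mono\<close>)

lemma tower_moderate_inverse: "tower moderate {0<..} m (\<lambda>t. inverse t)"
  by (intro moderate.tower_inverse moderate.tower_ident moderate_ident moderate_inverse) auto

lemma tower_flat_mult_moderate:
  "tower flat A m f \<Longrightarrow> tower moderate A m g \<Longrightarrow> tower flat A m (\<lambda>t. f t * g t)"
  by (rule tower_mult_general[where P = flat and Q = moderate and R = flat])
    (rule flat_mult_moderate, assumption, assumption, rule flat_add, assumption+)

lemma flat_cong:
  assumes "flat f" "\<And>t. t \<in> {0<..} \<Longrightarrow> f t = g t"
  shows "flat g"
  unfolding flat_def
proof
  fix n
  have "((\<lambda>t. f t / t ^ n) \<longlongrightarrow> 0) (at_right 0)" using assms(1) unfolding flat_def by blast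
  then show "((\<lambda>t. g t / t ^ n) \<longlongrightarrow> 0) (at_right 0)"
    by (rule Lim_transform_eventually)
       (use eventually_at_right_01 assms(2) in \<open>auto elim!: eventually_mono\<close>)
qed

lemma moderate_cong:
  assumes "moderate f" "\<And>t. t \<in> {0<..} \<Longrightarrow> f t = g t"
  shows "moderate g"
proof -
  obtain n C where "\<forall>\<^sub>F t in at_right 0. \<bar>f t\<bar> * t ^ n \<le> C"
    using assms(1) unfolding moderate_def by blast
  with eventually_at_right_01 have "\<forall>\<^sub>F t in at_right 0. \<bar>g t\<bar> * t ^ n \<le> C"
    by eventually_elim (use assms(2) in simp)
  then show ?thesis unfolding moderate_def by blast
qed

text \<open>Growth is a condition on the germ at 0, so a smooth function vanishing on
  \<open>(0, 1)\<close> satisfies it trivially. This admits the cutoff in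
  \<open>profile_denominator\<close>.\<close>

lemma tower_moderate_vanishing:
  assumes "smooth_upto {0<..} m f" "\<And>t. 0 < t \<Longrightarrow> t < 1 \<Longrightarrow> f t = 0"
  shows "tower moderate {0<..} m f"
  using assms
proof (induction m arbitrary: f)
  case (Suc m)
  obtain f' where f': "\<forall>t\<in>{0<..}. (f has_real_derivative f' t) (at t within {0<..})"
    "smooth_upto {0<..} m f'"
    by (rule tower_SucE[OF Suc.prems(1)])
  have "f' t = 0" if t: "0 < t" "t < 1" for t
  proof -
    have "(f has_real_derivative f' t) (at t)"
      using f'(1)[rule_format, of t] t by (simp add: at_within_open[of t "{0<..}"])
    moreover have "(f has_real_derivative 0) (at t)"
      by (rule has_field_derivative_transform_within_open[OF DERIV_const[of 0], of "{0<..<1}"])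
        (use t Suc.prems(2) in auto)
    ultimately show ?thesis by (rule DERIV_unique)
  qed
  then have "tower moderate {0<..} m f'" by (rule Suc.IH[OF f'(2)])
  moreover have "moderate f"
    by (rule moderateI[of _ 0]) (use eventually_at_right_01 Suc.prems(2) in \<open>auto elim!: eventually_mono\<close>)
  ultimately show ?case using f'(1) by auto
next
  case 0
  show ?case unfolding tower.simps
    by (rule moderateI[of _ 0]) (use eventually_at_right_01 0(2) in \<open>auto elim!: eventually_mono\<close>)
qed

lemma tower_flat_cong:
  "tower flat {0<..} m f \<Longrightarrow> (\<And>t. t > 0 \<Longrightarrow> f t = g t) \<Longrightarrow> tower flat {0<..} m g"
  using tower_cong[of flat "{0<..}" m f g] flat_cong by auto

lemma flat_divide:
  assumes "tower flat {0<..} m f"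
  shows "tower flat {0<..} m (\<lambda>t. f t / t ^ n)"
  using tower_flat_mult_moderate[OF assms moderate.tower_power[OF tower_moderate_inverse]]
  by (simp add: divide_inverse power_inverse)

lemma flat_exp: "tower flat {0<..} m (\<lambda>t. exp (- inverse t))"
proof (induction m)
  case 0
  show ?case unfolding tower.simps flat_def
  proof
    fix n
    have "((\<lambda>x::real. x ^ n / exp x) \<longlongrightarrow> 0) at_top" by (rule tendsto_power_div_exp_0)
    then have "((\<lambda>t::real. inverse t ^ n / exp (inverse t)) \<longlongrightarrow> 0) (at_right 0)"
      using filterlim_compose filterlim_inverse_at_top_right by blast
    then show "((\<lambda>t::real. exp (- inverse t) / t ^ n) \<longlongrightarrow> 0) (at_right 0)"
      by (simp add: exp_minus divide_inverse power_inverse mult.commute)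
  qed
next
  case (Suc m)
  show ?case
  proof (rule tower_SucI)
    show "tower flat {0<..} m (\<lambda>t. exp (- inverse t) * (inverse t * inverse t))"
      by (intro tower_flat_mult_moderate Suc moderate.tower_mult tower_moderate_inverse)
    show "((\<lambda>t::real. exp (- inverse t)) has_real_derivative exp (- inverse t) * (inverse t * inverse t)) (at t within {0<..})"
      if "t \<in> {0<..}" for t
      using that by (auto intro!: derivative_eq_intros simp: power2_eq_square)
  qed (use Suc tower_base in auto)
qed

text \<open>Integration gains one order: the mean value theorem on \<open>[s, t]\<close> bounds
  \<open>f t - f s\<close> by \<open>t\<close> times the bound on \<open>f'\<close>, and letting
  \<open>s\<close> tend to 0 removes \<open>f s\<close>.\<close>

lemma flat_order_Suc:
  fixes f f' :: "real \<Rightarrow> real"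
  assumes der: "\<And>t. t > 0 \<Longrightarrow> (f has_real_derivative f' t) (at t)"
    and lim: "(f \<longlongrightarrow> 0) (at_right 0)" "((\<lambda>t. f' t / t ^ n) \<longlongrightarrow> 0) (at_right 0)"
  shows "((\<lambda>t. f t / t ^ Suc n) \<longlongrightarrow> 0) (at_right 0)"
proof (rule tendstoI)
  fix e :: real assume "e > 0"
  then have "\<forall>\<^sub>F t in at_right 0. dist (f' t / t ^ n) 0 < e / 2"
    using lim(2) by (intro tendstoD) auto
  then obtain d where d: "d > 0" "\<And>t. 0 < t \<Longrightarrow> t < d \<Longrightarrow> \<bar>f' t / t ^ n\<bar> < e / 2"
    unfolding eventually_at_right_field by (auto simp: dist_real_def)
  have "\<bar>f t / t ^ Suc n\<bar> < e" if t: "0 < t" "t < d" for t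
  proof -
    have "\<bar>f t - f s\<bar> \<le> e / 2 * t ^ Suc n" if s: "0 < s" "s < t" for s
    proof -
      obtain z where z: "s < z" "z < t" "f t - f s = (t - s) * f' z"
        using MVT2[of s t f f'] der s by auto
      have "\<bar>f' z\<bar> = \<bar>f' z / z ^ n\<bar> * z ^ n" using z s by simp
      also have "\<dots> \<le> e / 2 * t ^ n"
        using d(2)[of z] z s t \<open>e > 0\<close> by (intro mult_mono power_mono) auto
      finally have "\<bar>f' z\<bar> \<le> e / 2 * t ^ n" .
      moreover have "\<bar>t - s\<bar> \<le> t" using s by auto
      ultimately have "\<bar>t - s\<bar> * \<bar>f' z\<bar> \<le> t * (e / 2 * t ^ n)"
        using s by (intro mult_mono) auto
      then show ?thesis using z(3) by (simp add: abs_mult mult_ac)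
    qed
    moreover have "\<forall>\<^sub>F s in at_right 0. 0 < s \<and> s < t"
      using eventually_at_right_real[OF t(1)] by simp
    ultimately have ev: "\<forall>\<^sub>F s in at_right 0. \<bar>f t - f s\<bar> \<le> e / 2 * t ^ Suc n"
      by (auto elim: eventually_mono)
    have "((\<lambda>s. \<bar>f t - f s\<bar>) \<longlongrightarrow> \<bar>f t - 0\<bar>) (at_right 0)"
      by (intro tendsto_intros lim(1))
    from tendsto_upperbound[OF this ev] have "\<bar>f t\<bar> \<le> e / 2 * t ^ Suc n" by simp
    \<comment> \<open>The estimate was made with \<open>e / 2\<close> because passing to the limit
      in \<open>s\<close> keeps only a weak inequality.\<close>
    also have "\<dots> < e * t ^ Suc n" using \<open>e > 0\<close> t by simp
    finally have "\<bar>f t\<bar> / t ^ Suc n < e" using t by (simp add: divide_less_eq)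
    then show ?thesis using t by (simp add: abs_divide abs_mult power_abs)
  qed
  then show "\<forall>\<^sub>F t in at_right 0. dist (f t / t ^ Suc n) 0 < e"
    unfolding eventually_at_right_field using d(1) by (auto simp: dist_real_def)
qed

text \<open>The induction on the order of decay treats all derivatives simultaneously: order
  \<open>n + 1\<close> for one derivative comes from order \<open>n\<close> for the next.\<close>

lemma O_infty_imp_flat:
  assumes "O_infty f"
  shows "tower flat {0<..} m f"
proof -
  have der: "((deriv ^^ j) f has_real_derivative (deriv ^^ Suc j) f t) (at t)" if "t > 0" for j t
  proof -
    have "(deriv ^^ j) f differentiable (at t)" using assms that unfolding O_infty_def by blast
    then show ?thesis by (simp add: DERIV_deriv_iff_real_differentiable)
  qed
  have lim: "((deriv ^^ j) f \<longlongrightarrow> 0) (at_right 0)" for j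
    using assms unfolding O_infty_def by blast
  have "((\<lambda>t. (deriv ^^ j) f t / t ^ n) \<longlongrightarrow> 0) (at_right 0)" for j n
  proof (induction n arbitrary: j)
    case 0
    then show ?case using lim by simp
  next
    case (Suc n)
    show ?case by (rule flat_order_Suc[OF der lim Suc])
  qed
  then have fl: "flat ((deriv ^^ j) f)" for j unfolding flat_def by blast
  have "tower flat {0<..} m ((deriv ^^ j) f)" for j
  proof (induction m arbitrary: j)
    case (Suc m)
    show ?case
      by (rule tower_SucI[OF fl _ Suc[of "Suc j"]]) (use der in \<open>auto intro: DERIV_subset\<close>)
  qed (use fl in auto)
  from this[of 0] show ?thesis by simp
qed

lemma tower_deriv:
  assumes "tower P {0<..} (Suc m) f"
    and cong: "\<And>f g. P f \<Longrightarrow> (\<And>t. t \<in> {0<..} \<Longrightarrow> f t = g t) \<Longrightarrow> P g"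
  shows "tower P {0<..} m (deriv f)"
proof -
  obtain f' where f': "\<forall>t\<in>{0<..}. (f has_real_derivative f' t) (at t within {0<..})"
    "tower P {0<..} m f'"
    by (rule tower_SucE[OF assms(1)])
  show ?thesis
  proof (rule tower_cong[OF f'(2) _ cong])
    show "f' t = deriv f t" if "t \<in> {0<..}" for t
      using f'(1)[rule_format, of t] that DERIV_imp_deriv[of f "f' t" t]
      by (simp add: at_within_open[of t "{0<..}"])
  qed
qed

lemma tower_flat_deriv: "tower flat {0<..} (Suc m) f \<Longrightarrow> tower flat {0<..} m (deriv f)"
  by (rule tower_deriv[OF _ flat_cong])

lemma tower_moderate_deriv: "tower moderate {0<..} (Suc m) f \<Longrightarrow> tower moderate {0<..} m (deriv f)"
  by (rule tower_deriv[OF _ moderate_cong])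

lemma flat_imp_O_infty:
  assumes "\<And>m. tower flat {0<..} m f"
  shows "O_infty f"
proof -
  have *: "tower flat {0<..} m ((deriv ^^ j) f)" for m j
    by (induction j arbitrary: m) (use assms in \<open>auto simp del: tower.simps intro: tower_flat_deriv\<close>)
  have "(deriv ^^ m) f differentiable at t" if "t > 0" for m t
  proof -
    obtain f' where "\<forall>t\<in>{0<..}. ((deriv ^^ m) f has_real_derivative f' t) (at t within {0<..})"
      by (rule tower_SucE[OF *[of "Suc 0" m]])
    from this[rule_format, of t] that have "((deriv ^^ m) f has_real_derivative f' t) (at t)"
      by (simp add: at_within_open[of t "{0<..}"])
    then show ?thesis using real_differentiable_def by blast
  qed
  moreover have "((deriv ^^ m) f \<longlongrightarrow> 0) (at_right 0)" for m
  proof -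
    have "((\<lambda>t. (deriv ^^ m) f t / t ^ 0) \<longlongrightarrow> 0) (at_right 0)"
      using *[of 0 m] unfolding tower.simps flat_def by blast
    then show ?thesis by simp
  qed
  ultimately show ?thesis unfolding O_infty_def by blast
qed

text \<open>Decay to order 1 makes the difference quotient at 0 tend to 0, so the derivative of the
  extension is the extension of the derivative. Flatness of all orders is assumed so that the
  hypothesis passes to the derivative.\<close>

lemma smooth_flat_extension:
  assumes "\<And>m. tower flat {0<..} m f"
  shows "smooth_upto UNIV m (\<lambda>t. if t > 0 then f t else 0)"
  using assms
proof (induction m arbitrary: f)
  case (Suc m)
  obtain f' where f': "\<And>t. t > 0 \<Longrightarrow> (f has_real_derivative f' t) (at t)"
    and "\<And>m. tower flat {0<..} m f'"
  proof
    show "tower flat {0<..} m (deriv f)" for m using Suc.prems tower_flat_deriv by blast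
    fix t :: real assume "t > 0"
    obtain f' where "\<forall>t\<in>{0<..}. (f has_real_derivative f' t) (at t within {0<..})"
      by (rule tower_SucE[OF Suc.prems[of "Suc 0"]])
    from this[rule_format, of t] \<open>t > 0\<close> have "(f has_real_derivative f' t) (at t)"
      by (simp add: at_within_open[of t "{0<..}"])
    then show "(f has_real_derivative deriv f t) (at t)" using DERIV_imp_deriv by metis
  qed
  let ?F = "\<lambda>t. if t > 0 then f t else 0" and ?G = "\<lambda>t. if t > 0 then f' t else 0"
  show ?case
  proof (rule tower_SucI)
    show "smooth_upto UNIV m ?G" by (rule Suc.IH) fact
    fix t :: real
    consider "t > 0" | "t < 0" | "t = 0" by linarith
    then show "(?F has_real_derivative ?G t) (at t within UNIV)"
    proof cases
      case 1
      have "(?F has_real_derivative f' t) (at t)"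
        by (rule has_field_derivative_transform_within_open[OF f'[OF 1], of "{0<..}"]) (use 1 in auto)
      then show ?thesis using 1 by simp
    next
      case 2
      have "(?F has_real_derivative 0) (at t)"
        by (rule has_field_derivative_transform_within_open[OF DERIV_const[of 0], of "{..<0}"]) (use 2 in auto)
      then show ?thesis using 2 by simp
    next
      case 3
      have "((\<lambda>t. f t / t ^ 1) \<longlongrightarrow> 0) (at_right 0)"
        using Suc.prems[of 0] unfolding tower.simps flat_def by blast
      then have r: "((\<lambda>t. ?F t / t) \<longlongrightarrow> 0) (at_right 0)"
        by (rule Lim_transform_eventually) (use eventually_at_right_01 in \<open>auto elim!: eventually_mono\<close>)
      have "((\<lambda>_. 0) \<longlongrightarrow> 0) (at_left (0::real))" by simp
      then have l: "((\<lambda>t. ?F t / t) \<longlongrightarrow> 0) (at_left 0)"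
        by (rule Lim_transform_eventually) (auto simp: eventually_at_left_field intro: exI[of _ "-1"])
      from r l have "((\<lambda>t. ?F t / t) \<longlongrightarrow> 0) (at 0)" by (simp add: filterlim_at_split)
      then show ?thesis using 3 by (simp add: has_field_derivative_iff)
    qed
  qed auto
qed auto

section \<open>Smooth functions of several variables\<close>

text \<open>A class of differentiable functions stable under \<open>partial\<close> is the invariant
  for an induction along the list of differentiations.\<close>

lemma smooth_funI:
  assumes "f \<in> S" "\<And>f. f \<in> S \<Longrightarrow> (\<forall>p. f differentiable at p) \<and> (\<forall>i. partial i f \<in> S)"
  shows "smooth_fun_on U f"
proof -
  have "foldr partial is f \<in> S" for "is" by (induction "is") (use assms in auto)
  then show ?thesis
    unfolding smooth_fun_on_def differentiable_on_def
    using assms(2) differentiable_at_withinI by blast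
qed

lemma partial_eqI: "(f has_derivative f') (at p) \<Longrightarrow> partial i f p = f' (axis i 1)"
  unfolding partial_def using frechet_derivative_at by metis

lemma smooth_fun_differentiable:
  "smooth_fun_on UNIV f \<Longrightarrow> f differentiable at p"
  unfolding smooth_fun_on_def differentiable_on_def by (metis UNIV_I foldr.simps(1) id_apply)

lemma smooth_fun_partial: "smooth_fun_on UNIV f \<Longrightarrow> smooth_fun_on UNIV (partial i f)"
  unfolding smooth_fun_on_def
  by (metis (no_types, opaque_lifting) comp_apply foldr.simps foldr_append id_apply)

lemma partial_const: "partial i (\<lambda>_. c) = (\<lambda>_. 0)"
  by (rule ext, rule partial_eqI[THEN trans, of _ "\<lambda>_. 0"]) auto

lemma partial_coord: "partial i (\<lambda>p. p $ j) = (\<lambda>_. if i = j then 1 else 0)"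
  by (rule ext, rule partial_eqI[THEN trans, OF bounded_linear.has_derivative[OF bounded_linear_vec_nth has_derivative_ident]])
     (auto simp: axis_def)

lemma partial_add:
  "f differentiable at p \<Longrightarrow> g differentiable at p \<Longrightarrow>
    partial i (\<lambda>p. f p + g p) p = partial i f p + partial i g p"
  by (rule partial_eqI[THEN trans, OF has_derivative_add])
     (auto simp: partial_def frechet_derivative_works[symmetric])

lemma partial_mult:
  fixes f g :: "real^'n::finite \<Rightarrow> real"
  shows "f differentiable at p \<Longrightarrow> g differentiable at p \<Longrightarrow>
    partial i (\<lambda>p. f p * g p) p = f p * partial i g p + partial i f p * g p"
  by (rule partial_eqI[THEN trans, OF has_derivative_mult])
     (auto simp: partial_def frechet_derivative_works[symmetric])

text \<open>The Leibniz rule leads from products to sums of products. The algebra spanned by the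
  generators is stable under \<open>partial\<close> as soon as it contains the partial derivatives
  of the generators, and then \<open>smooth_funI\<close> applies to it.\<close>

inductive_set algebra_span :: "(real^'n::finite \<Rightarrow> real) set \<Rightarrow> (real^'n \<Rightarrow> real) set" for G where
  gen: "f \<in> G \<Longrightarrow> f \<in> algebra_span G"
| add: "f \<in> algebra_span G \<Longrightarrow> g \<in> algebra_span G \<Longrightarrow> (\<lambda>p. f p + g p) \<in> algebra_span G"
| mult: "f \<in> algebra_span G \<Longrightarrow> g \<in> algebra_span G \<Longrightarrow> (\<lambda>p. f p * g p) \<in> algebra_span G"

lemma algebra_span_smooth:
  fixes f :: "real^'n::finite \<Rightarrow> real"
  assumes "f \<in> algebra_span G"
    and gen: "\<And>f. f \<in> G \<Longrightarrow> (\<forall>p. f differentiable at p) \<and> (\<forall>i. partial i f \<in> algebra_span G)"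
  shows "smooth_fun_on U f"
proof (rule smooth_funI[OF assms(1)])
  fix f :: "real^'n::finite \<Rightarrow> real"
  assume "f \<in> algebra_span G"
  then show "(\<forall>p. f differentiable at p) \<and> (\<forall>i. partial i f \<in> algebra_span G)"
  proof induction
    case (gen f)
    then show ?case by (rule assms(2))
  next
    case (add f g)
    then have "partial i (\<lambda>p. f p + g p) = (\<lambda>p. partial i f p + partial i g p)" for i
      using partial_add by blast
    with add show ?case by (auto intro: algebra_span.add)
  next
    case (mult f g)
    then have "partial i (\<lambda>p. f p * g p) = (\<lambda>p. f p * partial i g p + partial i f p * g p)" for i
      using partial_mult by blast
    moreover have "(\<lambda>p. f p * partial i g p + partial i f p * g p) \<in> algebra_span G" for i
      by (rule algebra_span.add; rule algebra_span.mult) (use mult in auto)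
    moreover have "(\<lambda>p. f p * g p) differentiable at p" for p
      using mult by (intro differentiable_mult) auto
    ultimately show ?case by simp
  qed
qed

lemma smooth_fun_generator:
  assumes "smooth_fun_on UNIV f" "Collect (smooth_fun_on UNIV) \<subseteq> G"
  shows "(\<forall>p. f differentiable at p) \<and> (\<forall>i. partial i f \<in> algebra_span G)"
  using assms smooth_fun_differentiable smooth_fun_partial by (blast intro: algebra_span.gen)

lemma smooth_fun_add:
  "smooth_fun_on UNIV f \<Longrightarrow> smooth_fun_on UNIV g \<Longrightarrow> smooth_fun_on UNIV (\<lambda>p. f p + g p)"
  by (rule algebra_span_smooth[of _ "Collect (smooth_fun_on UNIV)"])
    (auto intro: algebra_span.intros smooth_fun_differentiable smooth_fun_partial)

lemma smooth_fun_mult: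
  "smooth_fun_on UNIV f \<Longrightarrow> smooth_fun_on UNIV g \<Longrightarrow> smooth_fun_on UNIV (\<lambda>p. f p * g p)"
  by (rule algebra_span_smooth[of _ "Collect (smooth_fun_on UNIV)"])
    (auto intro: algebra_span.intros smooth_fun_differentiable smooth_fun_partial)

lemma smooth_fun_const: "smooth_fun_on U (\<lambda>_. c)"
  by (rule smooth_funI[of _ "range (\<lambda>c _. c)"]) (auto simp: partial_const)

lemma smooth_fun_coord: "smooth_fun_on U (\<lambda>p. p $ j)"
  by (rule smooth_funI[of _ "insert (\<lambda>p. p $ j) (range (\<lambda>c _. c))"])
     (auto simp: partial_const partial_coord bounded_linear_imp_differentiable bounded_linear_vec_nth)

lemma smooth_fun_power: "smooth_fun_on UNIV f \<Longrightarrow> smooth_fun_on UNIV (\<lambda>p. f p ^ n)"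
  by (induction n) (auto intro: smooth_fun_const smooth_fun_mult)

lemma smooth_fun_diff:
  assumes "smooth_fun_on UNIV f" "smooth_fun_on UNIV g"
  shows "smooth_fun_on UNIV (\<lambda>p. f p - g p)"
  using smooth_fun_add[OF assms(1) smooth_fun_mult[OF smooth_fun_const[of _ "-1"] assms(2)]] by simp

lemma smooth_fun_subset: "smooth_fun_on V f \<Longrightarrow> U \<subseteq> V \<Longrightarrow> smooth_fun_on U f"
  unfolding smooth_fun_on_def using differentiable_on_subset by blast

lemmas smooth_fun_intros = smooth_fun_const smooth_fun_coord smooth_fun_add smooth_fun_diff
  smooth_fun_mult smooth_fun_power

section \<open>Functions of the distance from the axis\<close>

definition radial :: "(real \<Rightarrow> real) \<Rightarrow> real^3 \<Rightarrow> real" where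
  "radial f p = (if cyl_radius p = 0 then 0 else f (cyl_radius p))"

lemma cyl_radius_nonneg [simp]: "cyl_radius p \<ge> 0"
  by (simp add: cyl_radius_def)

lemma cyl_radius_eq_0: "cyl_radius p = 0 \<longleftrightarrow> p$1 = 0 \<and> p$2 = 0"
  by (auto simp: cyl_radius_def sum_power2_eq_zero_iff)

lemma cyl_radius_sq: "(cyl_radius p)\<^sup>2 = (p$1)\<^sup>2 + (p$2)\<^sup>2"
  by (simp add: cyl_radius_def)

lemma cyl_radius_le_norm: "cyl_radius p \<le> norm p"
  unfolding cyl_radius_def norm_vec_def L2_set_def
  by (auto simp: sum_3 intro!: real_sqrt_le_mono)

lemma has_derivative_coord: "((\<lambda>p. p $ i) has_derivative (\<lambda>v. v $ i)) (at p)"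
  by (rule bounded_linear.has_derivative[OF bounded_linear_vec_nth has_derivative_ident])

lemma continuous_cyl_radius: "continuous_on UNIV cyl_radius"
  unfolding cyl_radius_def by (intro continuous_intros)

text \<open>Off the axis this is the chain rule with dr = (x dx + y dy) / r; the factor 1/r is
  absorbed into the profile, so that the derivative is again a coordinate times a radial function.
  On the axis, where \<open>radial\<close> takes the limit value 0, decay to order 1 makes the
  derivative vanish.\<close>

lemma radial_has_derivative:
  assumes fl: "\<And>m. tower flat {0<..} m f" and f': "\<And>t. t > 0 \<Longrightarrow> (f has_real_derivative f' t) (at t)"
  shows "(radial f has_derivative (\<lambda>v. (p$1 * v$1 + p$2 * v$2) * radial (\<lambda>t. f' t / t) p)) (at p)"
proof (cases "cyl_radius p = 0")
  case False
  then have pos: "cyl_radius p > 0" by (simp add: order_less_le)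
  have D: "((\<lambda>p. (p$1)\<^sup>2 + (p$2)\<^sup>2) has_derivative (\<lambda>v. 2 * (p$1 * v$1) + 2 * (p$2 * v$2))) (at p)"
    by (auto intro!: derivative_eq_intros has_derivative_coord simp: fun_eq_iff)
  have S: "(p$1)\<^sup>2 + (p$2)\<^sup>2 > 0" using pos unfolding cyl_radius_def by simp
  have "(cyl_radius has_derivative
      (\<lambda>v. inverse (cyl_radius p) / 2 * (2 * (p$1 * v$1) + 2 * (p$2 * v$2)))) (at p)"
    using has_derivative_compose[OF D, OF DERIV_real_sqrt[OF S, unfolded has_field_derivative_def]]
    unfolding cyl_radius_def by this
  moreover have "(\<lambda>v::real^3. inverse (cyl_radius p) / 2 * (2 * (p$1 * v$1) + 2 * (p$2 * v$2))) =
      (\<lambda>v. (p$1 * v$1 + p$2 * v$2) / cyl_radius p)"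
    using pos by (simp add: fun_eq_iff field_simps)
  ultimately have "(cyl_radius has_derivative (\<lambda>v. (p$1 * v$1 + p$2 * v$2) / cyl_radius p)) (at p)"
    by simp
  from has_derivative_compose[OF this, OF f'[OF pos, unfolded has_field_derivative_def]]
  have "((\<lambda>p. f (cyl_radius p)) has_derivative (\<lambda>v. (p$1 * v$1 + p$2 * v$2) * radial (\<lambda>t. f' t / t) p)) (at p)"
    using False by (simp add: radial_def mult.commute)
  moreover have "open {q. cyl_radius q \<noteq> 0}"
    by (intro open_Collect_neq continuous_cyl_radius continuous_on_const)
  ultimately show ?thesis
    by (rule has_derivative_transform_within_open) (use False in \<open>auto simp: radial_def\<close>)
next
  case True
  then have p: "p$1 = 0" "p$2 = 0" by (auto simp: cyl_radius_eq_0)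
  have "(radial f has_derivative (\<lambda>v. 0)) (at p)"
    unfolding has_derivative_at_alt
  proof (intro conjI allI impI)
    fix e :: real assume "e > 0"
    have "((\<lambda>t. f t / t ^ 1) \<longlongrightarrow> 0) (at_right 0)"
      using fl[of 0] unfolding tower.simps flat_def by blast
    from tendstoD[OF this \<open>e > 0\<close>] obtain d where d: "d > 0" "\<And>t. 0 < t \<Longrightarrow> t < d \<Longrightarrow> \<bar>f t / t\<bar> < e"
      unfolding eventually_at_right_field by (auto simp: dist_real_def)
    show "\<exists>d>0. \<forall>q. norm (q - p) < d \<longrightarrow> norm (radial f q - radial f p - 0) \<le> e * norm (q - p)"
    proof (intro exI[of _ d] conjI allI impI)
      fix q assume q: "norm (q - p) < d"
      have r: "cyl_radius q \<le> norm (q - p)"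
        using cyl_radius_le_norm[of "q - p"] p by (simp add: cyl_radius_def)
      show "norm (radial f q - radial f p - 0) \<le> e * norm (q - p)"
      proof (cases "cyl_radius q = 0")
        case False
        then have "cyl_radius q > 0" by (simp add: order_less_le)
        moreover from this have "\<bar>f (cyl_radius q) / cyl_radius q\<bar> < e" using r q by (intro d(2)) auto
        ultimately have "\<bar>f (cyl_radius q)\<bar> \<le> e * cyl_radius q" by (simp add: field_simps)
        also have "\<dots> \<le> e * norm (q - p)" using r \<open>e > 0\<close> by simp
        finally show ?thesis using False True by (simp add: radial_def)
      qed (use True \<open>e > 0\<close> in \<open>simp add: radial_def\<close>)
    qed (rule d(1))
  qed auto
  then show ?thesis using p by simp
qed

text \<open>If \<open>f\<close> is flat, so is \<open>f' / r\<close>; hence the derivative formula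
  stays within the algebra generated by radial functions of flat profile. The smooth functions join
  the generators in order to supply the coordinates.\<close>

lemma radial_smooth:
  assumes "\<And>m. tower flat {0<..} m f"
  shows "smooth_fun_on UNIV (radial f)"
proof -
  let ?S = "{radial f |f. \<forall>m. tower flat {0<..} m f}" and ?C = "Collect (smooth_fun_on UNIV)"
  show ?thesis
  proof (rule algebra_span_smooth[of _ "?S \<union> ?C"])
    show "radial f \<in> algebra_span (?S \<union> ?C)" using assms by (blast intro: algebra_span.gen)
    fix F assume "F \<in> ?S \<union> ?C"
    then show "(\<forall>p. F differentiable at p) \<and> (\<forall>i. partial i F \<in> algebra_span (?S \<union> ?C))"
    proof
      assume "F \<in> ?S"
      then obtain f where f: "\<And>m. tower flat {0<..} m f" "F = radial f" by blast
      have "(f has_real_derivative deriv f t) (at t)" if "t > 0" for t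
        using flat_imp_O_infty[OF f(1)] that unfolding O_infty_def
        by (metis DERIV_deriv_iff_real_differentiable funpow_0)
      note der = radial_has_derivative[OF f(1) this]
      let ?G = "radial (\<lambda>t. deriv f t / t)"
      have "tower flat {0<..} m (\<lambda>t. deriv f t / t)" for m
        using flat_divide[OF tower_flat_deriv[OF f(1)], of m 1] by simp
      then have G: "?G \<in> algebra_span (?S \<union> ?C)" by (blast intro: algebra_span.gen)
      have "partial i F = (\<lambda>p. (if i = 3 then 0 else 1) * p $ i * ?G p)" for i
      proof
        fix p
        show "partial i F p = (if i = 3 then 0 else 1) * p $ i * ?G p"
          using partial_eqI[OF der, of i p] exhaust_3[of i] unfolding f(2) by (auto simp: axis_def)
      qed
      moreover have "(\<lambda>p. (if i = 3 then 0 else 1) * p $ i * ?G p) \<in> algebra_span (?S \<union> ?C)" for i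
        by (rule algebra_span.mult[OF algebra_span.gen G])
          (use smooth_fun_mult[OF smooth_fun_const smooth_fun_coord] in blast)
      ultimately have "\<forall>i. partial i F \<in> algebra_span (?S \<union> ?C)" by simp
      moreover have "F differentiable at p" for p using der f(2) unfolding differentiable_def by blast
      ultimately show ?thesis by blast
    qed (intro smooth_fun_generator, auto)
  qed
qed

section \<open>Curvature of the metric along the plane\<close>

definition block :: "real \<Rightarrow> real \<Rightarrow> real \<Rightarrow> real \<Rightarrow> real^3^3" where
  "block a b d c = vector [vector [a, b, 0], vector [b, d, 0], vector [0, 0, c]]"

lemma block_nth [simp]:
  "block a b d c $ 1 $ 1 = a" "block a b d c $ 1 $ 2 = b" "block a b d c $ 1 $ 3 = 0"
  "block a b d c $ 2 $ 1 = b" "block a b d c $ 2 $ 2 = d" "block a b d c $ 2 $ 3 = 0"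
  "block a b d c $ 3 $ 1 = 0" "block a b d c $ 3 $ 2 = 0" "block a b d c $ 3 $ 3 = c"
  by (simp_all add: block_def)

lemma block_sym: "block a b d c $ i $ j = block a b d c $ j $ i"
  using exhaust_3[of i] exhaust_3[of j] by auto

lemma matrix_eq_3:
  fixes A B :: "real^3^3"
  shows "A = B \<longleftrightarrow> (\<forall>i j. A $ i $ j = B $ i $ j)"
  by (simp add: vec_eq_iff)

lemma mat_1_eq_block: "(mat 1 :: real^3^3) = block 1 0 1 1"
  unfolding matrix_eq_3 forall_3 by (simp add: mat_def)

lemma matrix_inv_block:
  assumes "a * d - b\<^sup>2 \<noteq> 0"
  shows "matrix_inv (block a b d 1) = block (d / (a * d - b\<^sup>2)) (- b / (a * d - b\<^sup>2)) (a / (a * d - b\<^sup>2)) 1"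
    (is "_ = ?B")
proof -
  let ?A = "block a b d 1"
  have AB: "?A ** ?B = mat 1" and BA: "?B ** ?A = mat 1"
    unfolding mat_1_eq_block unfolding matrix_eq_3 forall_3 using assms
    by (simp_all add: matrix_matrix_mult_def sum_3 mult.commute power2_eq_square
        flip: diff_divide_distrib add_divide_distrib)
  from AB BA have "?A ** ?B = mat 1 \<and> ?B ** ?A = mat 1" by blast
  \<comment> \<open>\<open>matrix_inv\<close> chooses some two-sided inverse. Exhibiting one makes
    the choice an inverse, and associativity then identifies the two.\<close>
  then have "?A ** matrix_inv ?A = mat 1"
    unfolding matrix_inv_def by (rule someI2) simp
  have "matrix_inv ?A = (?B ** ?A) ** matrix_inv ?A"
    unfolding BA by (rule matrix_mul_lid[symmetric])
  also have "\<dots> = ?B"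
    unfolding matrix_mul_assoc[symmetric] \<open>?A ** matrix_inv ?A = mat 1\<close> by (rule matrix_mul_rid)
  finally show ?thesis .
qed

lemma matrix_inv_mat_1: "matrix_inv (mat 1 :: real^'n::finite^'n) = mat 1"
proof -
  have "(mat 1 :: real^'n^'n) ** mat 1 = mat 1 \<and> (mat 1 :: real^'n^'n) ** mat 1 = mat 1"
    by (simp add: matrix_mul_lid)
  then have "(mat 1 :: real^'n^'n) ** matrix_inv (mat 1) = mat 1"
    unfolding matrix_inv_def by (rule someI2) simp
  then show ?thesis by (simp add: matrix_mul_lid)
qed

text \<open>Where \<open>h\<close> vanishes, continuity of \<open>f\<close> suffices: the error
  \<open>h q * (f q - f p)\<close> is a factor bounded by a multiple of \<open>norm (q - p)\<close>
  times a factor that tends to 0.\<close>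

lemma has_derivative_mult_null:
  fixes f h :: "'a::real_normed_vector \<Rightarrow> real"
  assumes h: "(h has_derivative h') (at p)" "h p = 0" and f: "isCont f p"
  shows "((\<lambda>q. h q * f q) has_derivative (\<lambda>v. h' v * f p)) (at p)"
proof -
  have "((\<lambda>q. h q * (f q - f p)) has_derivative (\<lambda>v. 0)) (at p)"
    unfolding has_derivative_at_alt
  proof (intro conjI allI impI)
    fix e :: real assume "e > 0"
    from has_derivative_bounded_linear[OF h(1)] obtain K where K: "K > 0" "\<And>v. norm (h' v) \<le> norm v * K"
      using bounded_linear.pos_bounded by metis
    obtain d1 where d1: "d1 > 0" "\<And>q. norm (q - p) < d1 \<Longrightarrow> norm (h q - h p - h' (q - p)) \<le> 1 * norm (q - p)"
      using h(1) unfolding has_derivative_at_alt by (metis zero_less_one)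
    from f have "\<exists>d>0. \<forall>q. dist q p < d \<longrightarrow> dist (f q) (f p) < e / (1 + K)"
      using \<open>e > 0\<close> K(1) unfolding continuous_at_eps_delta by simp
    then obtain d2 where d2: "d2 > 0" "\<And>q. dist q p < d2 \<Longrightarrow> dist (f q) (f p) < e / (1 + K)"
      by blast
    show "\<exists>d>0. \<forall>q. norm (q - p) < d \<longrightarrow>
        norm (h q * (f q - f p) - h p * (f p - f p) - 0) \<le> e * norm (q - p)"
    proof (intro exI[of _ "min d1 d2"] conjI allI impI)
      fix q assume q: "norm (q - p) < min d1 d2"
      have "norm (h q) \<le> norm (h q - h p - h' (q - p)) + norm (h' (q - p))"
        using norm_triangle_ineq[of "h q - h p - h' (q - p)" "h' (q - p)"] h(2) by simp
      also have "\<dots> \<le> (1 + K) * norm (q - p)"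
        using d1(2)[of q] K(2)[of "q - p"] q by (simp add: algebra_simps)
      finally have "norm (h q) \<le> (1 + K) * norm (q - p)" .
      moreover have "norm (f q - f p) \<le> e / (1 + K)"
        using d2(2)[of q] q by (simp add: dist_norm)
      ultimately have "norm (h q) * norm (f q - f p) \<le> (1 + K) * norm (q - p) * (e / (1 + K))"
        using K(1) by (intro mult_mono) auto
      then show "norm (h q * (f q - f p) - h p * (f p - f p) - 0) \<le> e * norm (q - p)"
        using K(1) by (simp add: abs_mult mult.commute)
    qed (use d1 d2 in auto)
  qed auto
  moreover have "((\<lambda>q. h q * f p) has_derivative (\<lambda>v. h' v * f p)) (at p)"
    by (rule has_derivative_mult_left[OF h(1)])
  ultimately have "((\<lambda>q. h q * (f q - f p) + h q * f p) has_derivative (\<lambda>v. 0 + h' v * f p)) (at p)"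
    by (rule has_derivative_add)
  then show ?thesis by (simp add: algebra_simps)
qed

lemma smooth_fun_isCont: "smooth_fun_on UNIV f \<Longrightarrow> isCont f p"
  using smooth_fun_differentiable differentiable_imp_continuous_within by blast

text \<open>The curvature on the plane is computed for every metric of the form identity plus
  \<open>z^2\<close> times a smooth planar block, before the particular coefficients of the
  cylindrical metric are inserted.\<close>

locale vertical_perturbation =
  fixes a b d :: "real^3 \<Rightarrow> real"
  assumes smooth_abd: "smooth_fun_on UNIV a" "smooth_fun_on UNIV b" "smooth_fun_on UNIV d"
begin

definition vmetric :: "real^3 \<Rightarrow> real^3^3" where
  "vmetric p = block (1 + (p$3)\<^sup>2 * a p) ((p$3)\<^sup>2 * b p) (1 + (p$3)\<^sup>2 * d p) 1"

definition vcoeff :: "3 \<Rightarrow> 3 \<Rightarrow> real^3 \<Rightarrow> real" where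
  "vcoeff i j p = block (a p) (b p) (d p) 0 $ i $ j"

lemma vcoeff_cases:
  "vcoeff 1 1 = a" "vcoeff 1 2 = b" "vcoeff 2 1 = b" "vcoeff 2 2 = d"
  "vcoeff 1 3 = (\<lambda>_. 0)" "vcoeff 3 1 = (\<lambda>_. 0)" "vcoeff 2 3 = (\<lambda>_. 0)" "vcoeff 3 2 = (\<lambda>_. 0)" "vcoeff 3 3 = (\<lambda>_. 0)"
  by (simp_all add: vcoeff_def fun_eq_iff)

lemma smooth_vcoeff: "smooth_fun_on UNIV (vcoeff i j)"
  using exhaust_3[of i] exhaust_3[of j] smooth_abd smooth_fun_const by (auto simp: vcoeff_cases)

lemma vmetric_eq: "vmetric p $ i $ j = mat 1 $ i $ j + p$3 * (p$3 * vcoeff i j p)"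
  using exhaust_3[of i] exhaust_3[of j]
  by (auto simp: vmetric_def vcoeff_def mat_1_eq_block power2_eq_square)

lemma smooth_vmetric: "smooth_tensor_on UNIV vmetric"
  unfolding smooth_tensor_on_def vmetric_eq by (intro allI smooth_fun_intros smooth_vcoeff)

text \<open>The components of the form dz, so that one formula serves all indices.\<close>

definition vert :: "3 \<Rightarrow> real" where
  "vert i = (if i = 3 then 1 else 0)"

lemma partial_vmetric:
  "partial k (\<lambda>p. vmetric p $ i $ j) p = p$3 * (p$3 * partial k (vcoeff i j) p + 2 * vert k * vcoeff i j p)"
proof -
  have dz: "(\<lambda>p::real^3. p$3) differentiable at p" for p
    by (simp add: smooth_fun_differentiable smooth_fun_coord)
  have dq: "vcoeff i j differentiable at p" for p
    by (rule smooth_fun_differentiable[OF smooth_vcoeff])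
  have "partial k (\<lambda>p. mat 1 $ i $ j + p$3 * (p$3 * vcoeff i j p)) p =
      p$3 * (p$3 * partial k (vcoeff i j) p + partial k (\<lambda>p. p$3) p * vcoeff i j p)
      + partial k (\<lambda>p. p$3) p * (p$3 * vcoeff i j p)"
    by (simp add: partial_add partial_mult partial_const dz dq)
  also have "partial k (\<lambda>p. p$3) p = vert k"
    by (simp add: partial_coord vert_def)
  finally show ?thesis unfolding vmetric_eq by (simp add: algebra_simps)
qed

text \<open>The first derivatives of the metric vanish where \<open>z = 0\<close>, so the Christoffel symbols are divisible
  by \<open>z\<close>; their derivatives on this plane are obtained from the continuity of the quotient.\<close>

definition christoffel_quotient :: "3 \<Rightarrow> 3 \<Rightarrow> 3 \<Rightarrow> real^3 \<Rightarrow> real" where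
  "christoffel_quotient k i j p = (\<Sum>l\<in>UNIV. matrix_inv (vmetric p) $ k $ l *
     ((p$3 * partial i (vcoeff l j) p + 2 * vert i * vcoeff l j p) + (p$3 * partial j (vcoeff l i) p + 2 * vert j * vcoeff l i p)
      - (p$3 * partial l (vcoeff i j) p + 2 * vert l * vcoeff i j p))) / 2"

lemma christoffel_vmetric: "christoffel vmetric k i j p = p$3 * christoffel_quotient k i j p"
  unfolding christoffel_def partial_vmetric christoffel_quotient_def
  by (simp add: sum_distrib_left algebra_simps)

lemma christoffel_null: "p$3 = 0 \<Longrightarrow> christoffel vmetric k i j p = 0"
  by (simp add: christoffel_vmetric)

lemma vmetric_null: "p$3 = 0 \<Longrightarrow> vmetric p = mat 1"
  by (simp add: vmetric_def mat_1_eq_block)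

lemma isCont_matrix_inv_vmetric:
  assumes "p$3 = 0"
  shows "isCont (\<lambda>p. matrix_inv (vmetric p) $ i $ j) p"
proof -
  define A B D where "A = (\<lambda>p. 1 + (p$3)\<^sup>2 * a p)" "B = (\<lambda>p. (p$3)\<^sup>2 * b p)" "D = (\<lambda>p. 1 + (p$3)\<^sup>2 * d p)"
  \<comment> \<open>The determinant of the planar block. It equals 1 at \<open>p\<close>, so it is
    nonzero nearby and the explicit inverse applies on a neighbourhood.\<close>
  define E where "E = (\<lambda>p. A p * D p - (B p)\<^sup>2)"
  have s: "smooth_fun_on UNIV A" "smooth_fun_on UNIV B" "smooth_fun_on UNIV D"
    unfolding A_B_D_def by (intro smooth_fun_intros smooth_abd)+
  then have "smooth_fun_on UNIV E" unfolding E_def by (intro smooth_fun_intros)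
  with s have c: "isCont A p" "isCont B p" "isCont D p" "isCont E p"
    using smooth_fun_isCont by blast+
  have "E p \<noteq> 0" using assms by (simp add: E_def A_B_D_def)
  then have "\<forall>\<^sub>F p in nhds p. E p \<noteq> 0"
    using c(4) tendsto_imp_eventually_ne[of E "E p" "nhds p" 0] by (simp add: isCont_def tendsto_nhds_iff)
  then have ev: "\<forall>\<^sub>F p in nhds p. block (D p / E p) (- B p / E p) (A p / E p) 1 $ i $ j = matrix_inv (vmetric p) $ i $ j"
    by eventually_elim (simp add: vmetric_def E_def A_B_D_def matrix_inv_block)
  have "isCont (\<lambda>p. block (D p / E p) (- B p / E p) (A p / E p) 1 $ i $ j) p"
    using exhaust_3[of i] exhaust_3[of j] c \<open>E p \<noteq> 0\<close> by (auto intro: isCont_divide isCont_minus)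
  then show ?thesis by (rule isCont_cong[OF ev, THEN iffD1])
qed

text \<open>Only the vertical derivative survives, and it is the value of the quotient at
  \<open>p\<close>. There the inverse metric is the identity, the terms with a factor
  \<open>z\<close> drop out, and the factor 2 from differentiating \<open>z^2\<close> cancels the
  1/2 of the Christoffel symbol.\<close>

lemma partial_christoffel:
  assumes "p$3 = 0"
  shows "partial m (christoffel vmetric k i j) p = vert m * (vert i * vcoeff k j p + vert j * vcoeff k i p - vert k * vcoeff i j p)"
proof -
  have "isCont (christoffel_quotient k i j) p"
    unfolding christoffel_quotient_def
    by (intro continuous_intros isCont_matrix_inv_vmetric assms smooth_fun_isCont smooth_fun_partial smooth_vcoeff
        smooth_fun_coord) simp
  from has_derivative_mult_null[OF has_derivative_coord assms this]
  have "(christoffel vmetric k i j has_derivative (\<lambda>v. v$3 * christoffel_quotient k i j p)) (at p)"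
    by (simp add: christoffel_vmetric[abs_def])
  then have "partial m (christoffel vmetric k i j) p = axis m 1 $ 3 * christoffel_quotient k i j p"
    by (rule partial_eqI)
  also have "axis m 1 $ 3 = vert m" by (simp add: axis_def vert_def)
  also have "christoffel_quotient k i j p = vert i * vcoeff k j p + vert j * vcoeff k i p - vert k * vcoeff i j p"
    using exhaust_3[of k] assms unfolding christoffel_quotient_def vmetric_null[OF assms] matrix_inv_mat_1
    by (auto simp: mat_def sum_3)
  finally show ?thesis .
qed

text \<open>The quadratic terms vanish with the Christoffel symbols. The planar components come from
  the vertical derivative of the symbols with upper index 3; the purely vertical component is minus
  the trace \<open>a p + d p\<close>, which is assumed to be 0.\<close>

lemma ricci_vmetric:
  assumes "p$3 = 0" "a p + d p = 0"
  shows "ricci vmetric p = block (- a p) (- b p) (- d p) 0"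
  using assms(2) unfolding matrix_eq_3 forall_3
  by (auto simp: ricci_def riemann_def partial_christoffel christoffel_null assms(1) sum_3 vert_def vcoeff_def)

lemma schouten_vmetric:
  assumes "p$3 = 0" "a p + d p = 0"
  shows "schouten vmetric p = block (- a p) (- b p) (- d p) 0"
proof -
  have "scalar_curvature vmetric p = 0"
    using assms(2) unfolding scalar_curvature_def ricci_vmetric[OF assms] vmetric_null[OF assms(1)] matrix_inv_mat_1
    by (simp add: mat_def sum_3)
  then show ?thesis by (simp add: schouten_def ricci_vmetric[OF assms])
qed

end

text \<open>In Cartesian components M has diagonal entries -2xy/r^2, 2xy/r^2 and off-diagonal entry
  (x^2 - y^2)/r^2. The division by r^2 is moved into the radial profile, where flatness makes it
  harmless.\<close>

definition cyl_diag :: "(real \<Rightarrow> real) \<Rightarrow> real^3 \<Rightarrow> real" where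
  "cyl_diag h p = - 2 * p$1 * p$2 * radial (\<lambda>r. h r / r\<^sup>2) p"

definition cyl_off :: "(real \<Rightarrow> real) \<Rightarrow> real^3 \<Rightarrow> real" where
  "cyl_off h p = ((p$1)\<^sup>2 - (p$2)\<^sup>2) * radial (\<lambda>r. h r / r\<^sup>2) p"

text \<open>The identity (2xy)^2 + (x^2 - y^2)^2 = (x^2 + y^2)^2: the square of h M is h^2 times the
  identity.\<close>

lemma cyl_diag_off_sq: "(cyl_diag h p)\<^sup>2 + (cyl_off h p)\<^sup>2 = (radial h p)\<^sup>2"
proof (cases "cyl_radius p = 0")
  case False
  have "(cyl_diag h p)\<^sup>2 + (cyl_off h p)\<^sup>2 = ((p$1)\<^sup>2 + (p$2)\<^sup>2)\<^sup>2 * (h (cyl_radius p) / (cyl_radius p)\<^sup>2)\<^sup>2"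
    using False by (simp add: cyl_diag_def cyl_off_def radial_def algebra_simps power2_eq_square)
  also have "\<dots> = (radial h p)\<^sup>2"
    using False unfolding cyl_radius_sq[symmetric] by (simp add: radial_def power_divide)
  finally show ?thesis .
qed (simp add: cyl_diag_def cyl_off_def radial_def)

section \<open>The cylindrical metric of a flat profile\<close>

locale flat_profile =
  fixes h :: "real \<Rightarrow> real"
  assumes flat_h: "\<And>m. tower flat {0<..} m h"
begin

lemma smooth_radial: "smooth_fun_on UNIV (radial h)" "smooth_fun_on UNIV (radial (\<lambda>r. h r / r\<^sup>2))"
  by (rule radial_smooth[OF flat_h]) (rule radial_smooth[OF flat_divide[OF flat_h]])

text \<open>The coefficients are those of (1 + h z^2 M)^2 - 1 = z^2 (h^2 z^2 + 2 h M) divided by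
  z^2. On the plane only 2 h M remains, whose trace is 0.\<close>

sublocale vertical_perturbation
  "\<lambda>p. (radial h p)\<^sup>2 * (p$3)\<^sup>2 + 2 * cyl_diag h p" "\<lambda>p. 2 * cyl_off h p"
  "\<lambda>p. (radial h p)\<^sup>2 * (p$3)\<^sup>2 - 2 * cyl_diag h p"
  by standard (unfold cyl_diag_def cyl_off_def, (intro smooth_fun_intros smooth_radial)+)

lemma cyl_metric_eq: "cyl_metric h = vmetric"
proof
  fix p
  show "cyl_metric h p = vmetric p"
  proof (cases "cyl_radius p = 0")
    case True
    then show ?thesis
      unfolding vmetric_def by (simp add: cyl_metric_def cyl_diag_def cyl_off_def radial_def mat_1_eq_block)
  next
    case False
    define x y z r k where "x = p$1" "y = p$2" "z = p$3" "r = cyl_radius p" "k = h r"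
    note defs = this
    have r: "r \<noteq> 0" "x * x + y * y = r * r"
      using False cyl_radius_sq[of p] by (simp_all add: defs power2_eq_square)
    let ?S = "\<lambda>i j. (1 + k\<^sup>2 * z ^ 4) * (symprod (cyl_dr p) (cyl_dr p) $ i $ j
        + r\<^sup>2 * symprod (cyl_dphi p) (cyl_dphi p) $ i $ j)
      + 4 * k * z\<^sup>2 * r * symprod (cyl_dr p) (cyl_dphi p) $ i $ j + symprod cyl_dz cyl_dz $ i $ j"
    have *: "cyl_metric h p $ i $ j = ?S i j" for i j
      using False by (simp add: cyl_metric_def Let_def defs)
    have dr: "cyl_dr p = vector [x / r, y / r, 0]" "cyl_dphi p = vector [- y / r\<^sup>2, x / r\<^sup>2, 0]"
      by (simp_all add: cyl_dr_def cyl_dphi_def defs)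
    have d: "cyl_diag h p = - 2 * x * y * k / r\<^sup>2" "cyl_off h p = (x\<^sup>2 - y\<^sup>2) * k / r\<^sup>2" "radial h p = k"
      using False by (simp_all add: cyl_diag_def cyl_off_def radial_def defs)
    have diag: "x * x / (r * r) + y * y / (r * r) = 1"
      using r by (simp flip: add_divide_distrib)
    have "?S 1 1 = (1 + k\<^sup>2 * z ^ 4) * (x * x / (r * r) + y * y / (r * r)) - 4 * k * z\<^sup>2 * x * y / r\<^sup>2"
      "?S 2 2 = (1 + k\<^sup>2 * z ^ 4) * (x * x / (r * r) + y * y / (r * r)) + 4 * k * z\<^sup>2 * x * y / r\<^sup>2"
      "?S 1 2 = 2 * k * z\<^sup>2 * (x * x - y * y) / r\<^sup>2" "?S 2 1 = 2 * k * z\<^sup>2 * (x * x - y * y) / r\<^sup>2"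
      unfolding dr cyl_dz_def symprod_def using r(1) by (simp_all add: field_simps power2_eq_square)
    note S = this[unfolded diag]
    have S3: "?S 1 3 = 0" "?S 2 3 = 0" "?S 3 1 = 0" "?S 3 2 = 0" "?S 3 3 = 1"
      unfolding dr cyl_dz_def symprod_def by simp_all
    show ?thesis
      unfolding matrix_eq_3 forall_3 * S S3 unfolding vmetric_def d defs(3)[symmetric]
      by (simp add: field_simps power2_eq_square power4_eq_xxxx)
  qed
qed

lemma cyl_domain_eq: "cyl_domain h = {p. \<bar>radial h p\<bar> * (p$3)\<^sup>2 \<noteq> 1}"
  by (auto simp: cyl_domain_def radial_def)

lemma plane_subset_cyl_domain: "{p. p$3 = 0} \<subseteq> cyl_domain h"
  by (auto simp: cyl_domain_def)

lemma smooth_cyl_metric: "smooth_tensor_on UNIV (cyl_metric h)"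
  unfolding cyl_metric_eq by (rule smooth_vmetric)

text \<open>The planar part of the quadratic form is the squared Euclidean length of (1 + h z^2 M)
  u, whose components are \<open>v\<close> and \<open>w\<close>. If it vanishes, h z^2 M maps the
  planar part of u to its negative; comparing lengths gives a factor \<open>H\<^sup>2 = 1\<close>,
  excluded on the domain, or a zero planar part.\<close>

lemma cyl_metric_positive:
  assumes "p \<in> cyl_domain h" "u \<noteq> 0"
  shows "0 < u \<bullet> (cyl_metric h p *v u)"
proof -
  define z E F H where "z = p$3" "E = cyl_diag h p * z\<^sup>2" "F = cyl_off h p * z\<^sup>2" "H = radial h p * z\<^sup>2"
  note defs = this
  have H: "E\<^sup>2 + F\<^sup>2 = H\<^sup>2" unfolding defs power_mult_distrib
    by (simp flip: distrib_right cyl_diag_off_sq)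
  have "\<bar>H\<bar> \<noteq> 1" using assms(1) by (auto simp: cyl_domain_eq defs abs_mult)
  then have H1: "H\<^sup>2 \<noteq> 1" by (simp add: abs_square_eq_1)
  define v w where "v = u$1 + E * u$1 + F * u$2" "w = u$2 + F * u$1 - E * u$2"
  have "u \<bullet> (cyl_metric h p *v u) = (1 + H\<^sup>2 + 2 * E) * (u$1)\<^sup>2 + 4 * F * u$1 * u$2
      + (1 + H\<^sup>2 - 2 * E) * (u$2)\<^sup>2 + (u$3)\<^sup>2"
    unfolding cyl_metric_eq vmetric_def
    by (simp add: inner_vec_def sum_3 matrix_vector_mult_def defs power2_eq_square algebra_simps)
  also have "\<dots> = v\<^sup>2 + w\<^sup>2 + (u$3)\<^sup>2"
    unfolding H[symmetric] v_w_def by (simp add: power2_eq_square algebra_simps)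
  finally have eq: "u \<bullet> (cyl_metric h p *v u) = v\<^sup>2 + w\<^sup>2 + (u$3)\<^sup>2" .
  have "v\<^sup>2 + w\<^sup>2 + (u$3)\<^sup>2 \<noteq> 0"
  proof
    assume "v\<^sup>2 + w\<^sup>2 + (u$3)\<^sup>2 = 0"
    then have z: "v = 0" "w = 0" "u$3 = 0"
      by (smt (verit) zero_le_power2 power2_eq_iff zero_eq_power2)+
    from z(1,2) have "u$1 = - (E * u$1 + F * u$2)" "u$2 = - (F * u$1 - E * u$2)"
      unfolding v_w_def by linarith+
    then have "(u$1)\<^sup>2 + (u$2)\<^sup>2 = (E * u$1 + F * u$2)\<^sup>2 + (F * u$1 - E * u$2)\<^sup>2"
      by (metis power2_minus)
    also have "\<dots> = H\<^sup>2 * ((u$1)\<^sup>2 + (u$2)\<^sup>2)"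
      unfolding H[symmetric] by (simp add: power2_eq_square algebra_simps)
    finally have "(u$1)\<^sup>2 + (u$2)\<^sup>2 = 0" using H1 by simp
    with z(3) have "u = 0" by (simp add: vec_eq_iff forall_3 sum_power2_eq_zero_iff)
    with assms(2) show False by blast
  qed
  moreover have "v\<^sup>2 + w\<^sup>2 + (u$3)\<^sup>2 \<ge> 0" by simp
  ultimately show ?thesis unfolding eq by linarith
qed

lemma riemannian_cyl_metric: "riemannian_metric_on (cyl_domain h) (cyl_metric h)"
  unfolding riemannian_metric_on_def
proof (intro conjI ballI allI impI cyl_metric_positive)
  have "continuous_on UNIV (radial h)"
    by (simp add: continuous_at_imp_continuous_on smooth_fun_isCont smooth_radial)
  then show "open (cyl_domain h)"
    unfolding cyl_domain_eq by (intro open_Collect_neq continuous_intros) auto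
  show "smooth_tensor_on (cyl_domain h) (cyl_metric h)"
    using smooth_cyl_metric smooth_fun_subset unfolding smooth_tensor_on_def by blast
  show "transpose (cyl_metric h p) = cyl_metric h p" for p
    unfolding cyl_metric_eq vmetric_def matrix_eq_3 transpose_def by (simp add: block_sym)
qed

lemma cyl_metric_plane:
  assumes "p$3 = 0"
  shows "cyl_metric h p = mat 1"
    and "christoffel (cyl_metric h) k i j p = 0"
    and "schouten (cyl_metric h) p = block (- 2 * cyl_diag h p) (- 2 * cyl_off h p) (2 * cyl_diag h p) 0"
  using assms schouten_vmetric[OF assms] unfolding cyl_metric_eq by (simp_all add: vmetric_null christoffel_null)

end

section \<open>The planar spiral and the profile function\<close>

lemma has_vector_derivative_vecI:
  fixes \<gamma> :: "real \<Rightarrow> real^'n::finite"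
  assumes "\<And>i. ((\<lambda>s. \<gamma> s $ i) has_real_derivative d $ i) (at s within A)"
  shows "(\<gamma> has_vector_derivative d) (at s within A)"
  unfolding has_vector_derivative_def has_derivative_componentwise_within[of \<gamma>]
  using assms by (auto simp: Basis_vec_def inner_axis has_field_derivative_def mult.commute[of _ "d $ _"])

text \<open>The set has no isolated points, so derivatives within it are unique, also the one-sided
  derivatives at an endpoint.\<close>

definition perfect_on :: "real set \<Rightarrow> bool" where
  "perfect_on A \<longleftrightarrow> (\<forall>s\<in>A. at s within A \<noteq> bot)"

lemma perfect_on_interval:
  assumes "is_interval A" "a \<in> A" "b \<in> A" "a \<noteq> b"
  shows "perfect_on A"
  unfolding perfect_on_def trivial_limit_within
  using connected_imp_perfect[of A] assms is_interval_connected by blast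

lemma velocity_eqI:
  assumes "perfect_on A" "s \<in> A" "(\<gamma> has_vector_derivative d) (at s within A)"
  shows "velocity A \<gamma> s = d"
  unfolding velocity_def using assms by (intro vector_derivative_within) (auto simp: perfect_on_def)

lemma vector_derivative_cong_on:
  assumes "perfect_on A" "s \<in> A" "(X has_vector_derivative d) (at s within A)"
    and "\<And>t. t \<in> A \<Longrightarrow> X t = Y t"
  shows "vector_derivative Y (at s within A) = d"
proof (rule vector_derivative_within)
  show "at s within A \<noteq> bot" using assms by (auto simp: perfect_on_def)
  show "(Y has_vector_derivative d) (at s within A)"
    by (rule has_vector_derivative_transform[OF assms(2) _ assms(3)]) (simp add: assms(4))
qed

lemma smooth_curve_onI:
  fixes \<gamma> :: "real \<Rightarrow> real^'n::finite"
  assumes "perfect_on A" "\<And>i m. smooth_upto A m (\<lambda>s. \<gamma> s $ i)"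
  shows "smooth_curve_on A \<gamma>"
proof -
  have step: "smooth_upto A m (\<lambda>s. velocity A \<gamma> s $ i) \<and> (\<forall>s\<in>A. \<gamma> differentiable (at s within A))"
    if \<gamma>: "\<And>i m. smooth_upto A m (\<lambda>s. \<gamma> s $ i)" for \<gamma> :: "real \<Rightarrow> real^'n" and m i
  proof -
    have "\<exists>d. (\<forall>s\<in>A. ((\<lambda>s. \<gamma> s $ i) has_real_derivative d s) (at s within A)) \<and> smooth_upto A m d" for i
      using \<gamma>[of "Suc m" i] by simp
    then obtain d where d: "\<forall>i. (\<forall>s\<in>A. ((\<lambda>s. \<gamma> s $ i) has_real_derivative d i s) (at s within A)) \<and> smooth_upto A m (d i)"
      by metis
    have D: "(\<gamma> has_vector_derivative (\<chi> i. d i s)) (at s within A)" if "s \<in> A" for s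
      by (rule has_vector_derivative_vecI) (use d that in simp)
    have "smooth_upto A m (\<lambda>s. velocity A \<gamma> s $ i)"
      by (rule smooth_cong[OF d[rule_format, THEN conjunct2, of i]])
        (use velocity_eqI[OF assms(1) _ D] in simp)
    with D show ?thesis using differentiableI_vector by blast
  qed
  have "smooth_upto A m (\<lambda>s. (velocity A ^^ n) \<gamma> s $ i)" for n m i
  proof (induction n arbitrary: m i)
    case (Suc n)
    show ?case using step[OF Suc] by simp
  qed (simp add: assms)
  then show ?thesis
    unfolding smooth_curve_on_def differentiable_on_def using step by blast
qed

lemma matrix_2_eq:
  fixes A B :: "real^2^2"
  shows "A = B \<longleftrightarrow> A$1$1 = B$1$1 \<and> A$1$2 = B$1$2 \<and> A$2$1 = B$2$1 \<and> A$2$2 = B$2$2"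
  by (auto simp: vec_eq_iff forall_2)

section \<open>The derivatives of the spiral\<close>

definition spiral_x :: "real \<Rightarrow> real" where "spiral_x t = t * cos (exp (1/t))"
definition spiral_y :: "real \<Rightarrow> real" where "spiral_y t = t * sin (exp (1/t))"

text \<open>The angular component \<open>r \<phi>'\<close> of the velocity in the frame \<open>(e\<^sub>r, e\<^sub>\<phi>)\<close>; the radial component is \<open>1\<close>.\<close>
definition spiral_w :: "real \<Rightarrow> real" where "spiral_w t = - exp (1/t) / t"
definition spiral_w' :: "real \<Rightarrow> real" where "spiral_w' t = exp (1/t) / t\<^sup>2 + exp (1/t) / t ^ 3"
definition spiral_x' :: "real \<Rightarrow> real" where
  "spiral_x' t = cos (exp (1/t)) - spiral_w t * sin (exp (1/t))"
definition spiral_y' :: "real \<Rightarrow> real" where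
  "spiral_y' t = sin (exp (1/t)) + spiral_w t * cos (exp (1/t))"
text \<open>In the frame (e_r, e_phi) the acceleration has the components -w^2/t and w/t + w', where
  w is \<open>spiral_w\<close>.\<close>

definition spiral_x'' :: "real \<Rightarrow> real" where
  "spiral_x'' t = - (spiral_w t / t + spiral_w' t) * sin (exp (1/t)) - (spiral_w t)\<^sup>2 / t * cos (exp (1/t))"
definition spiral_y'' :: "real \<Rightarrow> real" where
  "spiral_y'' t = (spiral_w t / t + spiral_w' t) * cos (exp (1/t)) - (spiral_w t)\<^sup>2 / t * sin (exp (1/t))"
definition spiral_speed :: "real \<Rightarrow> real" where "spiral_speed t = sqrt (1 + (spiral_w t)\<^sup>2)"
text \<open>The signed Euclidean curvature: the numerator is the determinant of the velocity (1, w)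
  and the acceleration (-w^2/t, w/t + w') in the polar frame.\<close>

definition curvature :: "real \<Rightarrow> real" where
  "curvature t = (spiral_w t / t + spiral_w' t + (spiral_w t) ^ 3 / t) / spiral_speed t ^ 3"

lemma spiral_speed_pos [simp]: "spiral_speed t > 0"
  unfolding spiral_speed_def by (simp add: add_pos_nonneg)

lemma spiral_speed_nonzero [simp]: "spiral_speed t \<noteq> 0"
  using spiral_speed_pos[of t] by (simp del: spiral_speed_pos)

lemma spiral_speed_sq: "(spiral_speed t)\<^sup>2 = 1 + (spiral_w t)\<^sup>2"
  by (simp add: spiral_speed_def)

lemma spiral_derivs:
  assumes "t > 0"
  shows "(spiral_x has_real_derivative spiral_x' t) (at t within A)"
    and "(spiral_y has_real_derivative spiral_y' t) (at t within A)"
    and "(spiral_w has_real_derivative spiral_w' t) (at t within A)"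
    and "(spiral_x' has_real_derivative spiral_x'' t) (at t within A)"
    and "(spiral_y' has_real_derivative spiral_y'' t) (at t within A)"
proof -
  have e: "((\<lambda>t. exp (1/t)) has_real_derivative spiral_w t / t) (at t within A)"
    using assms unfolding spiral_w_def
    by (auto intro!: derivative_eq_intros simp: field_simps power2_eq_square)
  show "(spiral_w has_real_derivative spiral_w' t) (at t within A)"
    using assms unfolding spiral_w_def[abs_def] spiral_w'_def
    by (auto intro!: derivative_eq_intros simp: field_simps power2_eq_square power3_eq_cube)
  note w = this
  have c: "((\<lambda>t. cos (exp (1/t))) has_real_derivative - (spiral_w t / t) * sin (exp (1/t))) (at t within A)"
    using DERIV_chain2[OF DERIV_cos e] by (simp add: mult.commute)
  have s: "((\<lambda>t. sin (exp (1/t))) has_real_derivative (spiral_w t / t) * cos (exp (1/t))) (at t within A)"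
    using DERIV_chain2[OF DERIV_sin e] by (simp add: mult.commute)
  show "(spiral_x has_real_derivative spiral_x' t) (at t within A)"
    using DERIV_mult[OF DERIV_ident c] assms unfolding spiral_x_def[abs_def] spiral_x'_def by simp
  show "(spiral_y has_real_derivative spiral_y' t) (at t within A)"
    using DERIV_mult[OF DERIV_ident s] assms unfolding spiral_y_def[abs_def] spiral_y'_def
    by (simp add: add.commute)
  show "(spiral_x' has_real_derivative spiral_x'' t) (at t within A)"
    unfolding spiral_x'_def[abs_def] spiral_x''_def
    by (rule DERIV_cong[OF DERIV_diff[OF c DERIV_mult[OF w s]]]) (simp add: algebra_simps power2_eq_square)
  show "(spiral_y' has_real_derivative spiral_y'' t) (at t within A)"
    unfolding spiral_y'_def[abs_def] spiral_y''_def
    by (rule DERIV_cong[OF DERIV_add[OF s DERIV_mult[OF w c]]]) (simp add: algebra_simps power2_eq_square)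
qed

lemma spiral_position_sq: "(spiral_x t)\<^sup>2 + (spiral_y t)\<^sup>2 = t\<^sup>2"
  unfolding spiral_x_def spiral_y_def power_mult_distrib
  by (simp flip: distrib_left)

lemma spiral_velocity_sq: "(spiral_x' t)\<^sup>2 + (spiral_y' t)\<^sup>2 = (spiral_speed t)\<^sup>2"
proof -
  have "(c - w * s)\<^sup>2 + (s + w * c)\<^sup>2 = (1 + w\<^sup>2) * (c\<^sup>2 + s\<^sup>2)" for c s w :: real
    by (simp add: power2_eq_square algebra_simps)
  then show ?thesis by (simp add: spiral_x'_def spiral_y'_def spiral_speed_sq)
qed

lemma spiral_wedge:
  "spiral_x' t * spiral_y'' t - spiral_x'' t * spiral_y' t = curvature t * spiral_speed t ^ 3"
proof -
  have "(c - w * s) * (p * c - w\<^sup>2 / t * s) - (- p * s - w\<^sup>2 / t * c) * (s + w * c) = (p + w ^ 3 / t) * (c\<^sup>2 + s\<^sup>2)"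
    for c s w p :: real
    by (simp add: power2_eq_square power3_eq_cube algebra_simps add_divide_distrib diff_divide_distrib)
  from this[where c = "cos (exp (1/t))" and s = "sin (exp (1/t))" and w = "spiral_w t" and p = "spiral_w t / t + spiral_w' t"]
  have "spiral_x' t * spiral_y'' t - spiral_x'' t * spiral_y' t =
      spiral_w t / t + spiral_w' t + (spiral_w t) ^ 3 / t"
    unfolding spiral_x'_def spiral_y'_def spiral_x''_def spiral_y''_def
    by (simp only: sin_cos_squared_add2 mult_1_right)
  moreover have "spiral_speed t ^ 3 \<noteq> 0" by simp
  ultimately show ?thesis unfolding curvature_def by simp
qed

text \<open>Along the spiral these entries of M are -sin(2 phi) and cos(2 phi).\<close>

definition M_diag :: "real \<Rightarrow> real" where "M_diag t = - 2 * spiral_x t * spiral_y t / t\<^sup>2"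
definition M_off :: "real \<Rightarrow> real" where "M_off t = ((spiral_x t)\<^sup>2 - (spiral_y t)\<^sup>2) / t\<^sup>2"

text \<open>M exchanges e_r and e_phi. It therefore maps the velocity (1, w) to (w, 1), and the
  determinant of the two is 1 - w^2.\<close>

lemma spiral_wedge_M:
  assumes "t > 0"
  shows "spiral_x' t * (M_off t * spiral_x' t - M_diag t * spiral_y' t)
     - (M_diag t * spiral_x' t + M_off t * spiral_y' t) * spiral_y' t = 1 - (spiral_w t)\<^sup>2"
proof -
  define c s w where "c = cos (exp (1/t))" "s = sin (exp (1/t))" "w = spiral_w t"
  have M: "M_diag t = - 2 * c * s" "M_off t = c * c - s * s"
    using assms by (simp_all add: M_diag_def M_off_def spiral_x_def spiral_y_def c_s_w_def field_simps power2_eq_square)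
  have "(c - w * s) * ((c * c - s * s) * (c - w * s) - - 2 * c * s * (s + w * c))
     - (- 2 * c * s * (c - w * s) + (c * c - s * s) * (s + w * c)) * (s + w * c) = (1 - w\<^sup>2) * (c\<^sup>2 + s\<^sup>2)\<^sup>2"
    for c s w :: real
    by (simp add: power2_eq_square algebra_simps)
  then show ?thesis
    unfolding M spiral_x'_def spiral_y'_def c_s_w_def[symmetric] by (simp only: c_s_w_def) simp
qed

section \<open>Growth of the curvature and an explicit profile\<close>

lemma smooth_inverse_arg: "smooth_upto {0<..} m (\<lambda>t. exp (1 / t))"
proof -
  have "smooth_upto {0<..} m (\<lambda>t. inverse t)"
    by (intro smooth.tower_inverse smooth.tower_ident) auto
  from smooth_compose[OF smooth_exp[of UNIV] this] show ?thesis by (simp add: inverse_eq_divide)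
qed

lemma smooth_spiral:
  "smooth_upto {0<..} m spiral_x" "smooth_upto {0<..} m spiral_y"
  "smooth_upto {0<..} m spiral_w" "smooth_upto {0<..} m spiral_speed"
proof -
  note e = smooth_inverse_arg
  have id: "smooth_upto {0<..} m (\<lambda>t. t)" by (rule smooth.tower_ident) simp
  have inv: "smooth_upto {0<..} m (\<lambda>t. inverse t)"
    by (intro smooth.tower_inverse id) auto
  show "smooth_upto {0<..} m spiral_x" unfolding spiral_x_def[abs_def]
    by (intro smooth.tower_mult id smooth_compose[OF smooth_sin_cos[THEN conjunct2] e]) (rule subset_UNIV)
  show "smooth_upto {0<..} m spiral_y" unfolding spiral_y_def[abs_def]
    by (intro smooth.tower_mult id smooth_compose[OF smooth_sin_cos[THEN conjunct1] e]) (rule subset_UNIV)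
  show w: "smooth_upto {0<..} m spiral_w" unfolding spiral_w_def[abs_def] divide_inverse[of _ t for t]
    by (intro smooth.tower_mult smooth.tower_minus e[unfolded divide_inverse] inv)
  show "smooth_upto {0<..} m spiral_speed" unfolding spiral_speed_def[abs_def]
    by (intro smooth.tower_sqrt smooth.tower_plus smooth.tower_const smooth.tower_power w)
      (auto simp: add_pos_nonneg)
qed

definition spiral_q :: "real \<Rightarrow> real" where "spiral_q t = t * exp (- inverse t)"

lemma spiral_w_q: "t > 0 \<Longrightarrow> spiral_w t = - inverse (spiral_q t)"
  by (simp add: spiral_w_def spiral_q_def exp_minus field_simps)

lemma spiral_speed_q: "t > 0 \<Longrightarrow> spiral_speed t = sqrt (1 + (spiral_q t)\<^sup>2) / spiral_q t"
proof -
  assume "t > 0"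
  then have q: "spiral_q t > 0" by (simp add: spiral_q_def)
  have "1 + (spiral_w t)\<^sup>2 = (1 + (spiral_q t)\<^sup>2) / (spiral_q t)\<^sup>2"
    using q by (simp add: spiral_w_q[OF \<open>t > 0\<close>] field_simps power2_eq_square)
  then show ?thesis using q by (simp add: spiral_speed_def real_sqrt_divide)
qed

text \<open>In this form the curvature is visibly smooth with derivatives of at most polynomial growth.\<close>

lemma curvature_q:
  assumes "t > 0"
  shows "curvature t = (exp (- inverse t) ^ 2 - inverse t) * inverse (sqrt (1 + (spiral_q t)\<^sup>2)) ^ 3"
proof -
  define e where "e = exp (1 / t)"
  define R where "R = sqrt (1 + (spiral_q t)\<^sup>2)"
  have e: "e > 0" "exp (- inverse t) = inverse e" "spiral_q t = t * inverse e"
    by (simp_all add: e_def spiral_q_def exp_minus inverse_eq_divide)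
  have R: "R > 0" unfolding R_def by (simp add: add_pos_nonneg)
  have "spiral_w t / t + spiral_w' t + (spiral_w t) ^ 3 / t = e / t ^ 3 - e ^ 3 / t ^ 4"
    using assms by (simp add: spiral_w_def spiral_w'_def e_def[symmetric] field_simps power2_eq_square power3_eq_cube power4_eq_xxxx)
  then have "curvature t = (e / t ^ 3 - e ^ 3 / t ^ 4) / (R / (t * inverse e)) ^ 3"
    unfolding curvature_def spiral_speed_q[OF assms] R_def[symmetric] unfolding e(3) by simp
  also have "\<dots> = (inverse e ^ 2 - inverse t) * inverse R ^ 3"
    using assms e(1) R by (simp add: field_simps power2_eq_square power3_eq_cube power4_eq_xxxx)
  finally show ?thesis unfolding e(2) R_def .
qed

lemma moderate_q: "tower moderate {0<..} m spiral_q"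
  unfolding spiral_q_def[abs_def]
  by (intro moderate.tower_mult moderate.tower_ident moderate_ident tower_weaken[OF flat_exp flat_imp_moderate])

lemma flat_q: "tower flat {0<..} m spiral_q"
  unfolding spiral_q_def[abs_def] mult.commute[of _ "exp _"]
  by (intro tower_flat_mult_moderate flat_exp moderate.tower_ident moderate_ident)

lemma spiral_q_le: "t > 0 \<Longrightarrow> 0 < spiral_q t \<and> spiral_q t \<le> t"
  by (simp add: spiral_q_def mult_le_cancel_left2)

lemma moderate_root: "tower moderate {0<..} m (\<lambda>t. sqrt (1 + (spiral_q t)\<^sup>2))"
  "tower moderate {0<..} m (\<lambda>t. inverse (sqrt (1 + (spiral_q t)\<^sup>2)))"
proof -
  have s: "tower moderate {0<..} m (\<lambda>t. 1 + (spiral_q t)\<^sup>2)"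
    by (intro moderate.tower_plus moderate.tower_const moderate.tower_power moderate_q)
  have ge: "1 \<le> 1 + (spiral_q t)\<^sup>2" for t by simp
  show r: "tower moderate {0<..} m (\<lambda>t. sqrt (1 + (spiral_q t)\<^sup>2))"
  proof (rule moderate.tower_sqrt[OF s])
    have "\<bar>sqrt (1 + (spiral_q t)\<^sup>2)\<bar> \<le> 2" if "0 < t \<and> t < 1" for t
    proof -
      have "(spiral_q t)\<^sup>2 \<le> 1" using spiral_q_le[of t] that by (simp add: abs_square_le_1)
      then show ?thesis using real_sqrt_le_mono[of "1 + (spiral_q t)\<^sup>2" "2\<^sup>2"] by simp
    qed
    then show "moderate (\<lambda>t. sqrt (1 + (spiral_q t)\<^sup>2))"
      by (intro moderateI[of _ 2] eventually_mono[OF eventually_at_right_01])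
    show "moderate (\<lambda>t. inverse (1 + (spiral_q t)\<^sup>2))"
      by (intro moderateI[of _ 1]) (simp add: inverse_le_1_iff)
  qed (simp add: add_pos_nonneg)
  show "tower moderate {0<..} m (\<lambda>t. inverse (sqrt (1 + (spiral_q t)\<^sup>2)))"
  proof (rule moderate.tower_inverse[OF r])
    show "moderate (\<lambda>t. inverse (sqrt (1 + (spiral_q t)\<^sup>2)))"
      by (intro moderateI[of _ 1]) (simp add: inverse_le_1_iff)
  qed (simp add: add_nonneg_eq_0_iff)
qed

lemma moderate_curvature: "tower moderate {0<..} m curvature"
proof (rule tower_cong)
  show "tower moderate {0<..} m (\<lambda>t. (exp (- inverse t) ^ 2 - inverse t) * inverse (sqrt (1 + (spiral_q t)\<^sup>2)) ^ 3)"
    by (intro moderate.tower_mult moderate.tower_diff moderate.tower_power moderate_root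
        tower_moderate_inverse tower_weaken[OF flat_exp flat_imp_moderate])
  show "moderate g" if "moderate f" "\<And>t. t \<in> {0<..} \<Longrightarrow> f t = g t" for f g
    using that by (rule moderate_cong)
qed (simp add: curvature_q)

lemma curvature_deriv: "t > 0 \<Longrightarrow> (curvature has_real_derivative deriv curvature t) (at t within A)"
proof -
  assume "t > 0"
  obtain d where "\<forall>t\<in>{0<..}. (curvature has_real_derivative d t) (at t within {0<..})"
    by (rule tower_SucE[OF moderate_curvature[of "Suc 0"]])
  from this[rule_format, of t] \<open>t > 0\<close> have "(curvature has_real_derivative d t) (at t)"
    by (simp add: at_within_open[of t "{0<..}"])
  then show ?thesis using DERIV_imp_deriv has_field_derivative_at_within by metis
qed

text \<open>On \<open>(0, 1]\<close> the equation for \<open>k\<close> has the solution \<open>k = curvature' q (1 + q\<^sup>2)\<^bsup>1/2\<^esup> / (q\<^sup>2 - 1)\<close>, whose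
  denominator vanishes at some \<open>t > 1\<close>.  Subtracting a smooth function supported in \<open>[1, \<infinity>)\<close> from the
  denominator makes it negative for all \<open>t > 0\<close>.\<close>

definition profile_denominator :: "real \<Rightarrow> real" where
  "profile_denominator t = (spiral_q t)\<^sup>2 - 1 - 8 * t\<^sup>2 * (if t - 1 > 0 then exp (- inverse (t - 1)) else 0)"

text \<open>Up to 3/2 the first term is small enough: q is at most 3/2 exp(-2/3), which is below 3/2
  * 3/5 < 1. Beyond 3/2 the cutoff is at least exp(-2), hence at least 1/8; with the constant 8 the
  subtracted term is at least t^2, which dominates q^2.\<close>

lemma profile_denominator_neg:
  assumes "t > 0"
  shows "profile_denominator t < 0"
proof (cases "t \<le> 3/2")
  case True
  have "exp (2/3 :: real) \<ge> 1 + 2/3" by (rule exp_ge_add_one_self)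
  then have "exp (- (2/3) :: real) \<le> 3/5" by (simp add: exp_minus field_simps)
  moreover have "exp (- inverse t) \<le> exp (- (2/3))" using True assms by (simp add: field_simps)
  ultimately have "exp (- inverse t) \<le> 3/5" by linarith
  then have "spiral_q t \<le> 3/2 * (3/5)"
    unfolding spiral_q_def using True assms by (intro mult_mono) auto
  then have "(spiral_q t)\<^sup>2 < 1"
    using spiral_q_le[OF assms] by (simp add: abs_square_less_1)
  moreover have "8 * t\<^sup>2 * (if t - 1 > 0 then exp (- inverse (t - 1)) else 0) \<ge> 0" by simp
  ultimately show ?thesis unfolding profile_denominator_def by linarith
next
  case False
  have "exp (1::real) < 272/100" using e_less_272 by simp
  then have "exp (1::real) * exp 1 \<le> 272/100 * (272/100)" by (intro mult_mono) auto
  then have "exp (2::real) \<le> 8" using exp_add[of "1::real" 1] by simp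
  then have "1 / 8 \<le> exp (- 2 :: real)" by (simp add: exp_minus field_simps)
  also have "\<dots> \<le> exp (- inverse (t - 1))" using False by (simp add: field_simps)
  finally have "8 * t\<^sup>2 * (1 / 8) \<le> 8 * t\<^sup>2 * exp (- inverse (t - 1))" by (intro mult_left_mono) auto
  moreover have "(spiral_q t)\<^sup>2 \<le> t\<^sup>2" using spiral_q_le[OF assms] by (intro power_mono) auto
  moreover have "profile_denominator t = (spiral_q t)\<^sup>2 - 1 - 8 * t\<^sup>2 * exp (- inverse (t - 1))"
    using False by (simp add: profile_denominator_def)
  ultimately show ?thesis by linarith
qed

lemma moderate_profile_denominator: "tower moderate {0<..} m (\<lambda>t. inverse (profile_denominator t))"
proof (rule moderate.tower_inverse)
  have "smooth_upto {0<..} m (\<lambda>t. (\<lambda>s. if s > 0 then exp (- inverse s) else 0) (t - 1))"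
    by (rule smooth_compose[OF smooth_flat_extension[OF flat_exp]])
      (auto intro!: smooth.tower_diff smooth.tower_ident smooth.tower_const)
  then have bump: "tower moderate {0<..} m (\<lambda>t. if t - 1 > 0 then exp (- inverse (t - 1)) else 0)"
    by (intro tower_moderate_vanishing) auto
  show "tower moderate {0<..} m profile_denominator"
    unfolding profile_denominator_def[abs_def]
    by (intro moderate.tower_diff moderate.tower_mult moderate.tower_power moderate.tower_const moderate_q bump
        moderate.tower_ident moderate_ident)
  show "profile_denominator t \<noteq> 0" if "t \<in> {0<..}" for t
    using profile_denominator_neg[of t] that by simp
  have "\<bar>inverse (profile_denominator t)\<bar> \<le> 2" if "0 < t \<and> t < 1/2" for t
  proof -
    have "(spiral_q t)\<^sup>2 \<le> (1/2)\<^sup>2" using spiral_q_le[of t] that by (intro power_mono) auto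
    then have "profile_denominator t \<le> - (1/2)"
      using that by (simp add: profile_denominator_def power2_eq_square)
    then show ?thesis by (simp add: abs_if field_simps)
  qed
  moreover have "\<forall>\<^sub>F t in at_right (0::real). 0 < t \<and> t < 1/2"
    using eventually_at_right_real[of 0 "1/2::real"] by simp
  ultimately show "moderate (\<lambda>t. inverse (profile_denominator t))"
    by (intro moderateI[of _ 2]) (auto elim: eventually_mono)
qed

definition profile :: "real \<Rightarrow> real" where
  "profile t = spiral_q t * (deriv curvature t * sqrt (1 + (spiral_q t)\<^sup>2) * inverse (profile_denominator t))"

text \<open>The factor \<open>spiral_q\<close> supplies all the decay; the remaining factors grow at
  most polynomially.\<close>

lemma profile_flat: "tower flat {0<..} m profile"
  unfolding profile_def[abs_def]
  by (intro tower_flat_mult_moderate flat_q moderate.tower_mult moderate_root moderate_profile_denominator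
      tower_moderate_deriv moderate_curvature)

lemma profile_equation:
  assumes "t \<in> {0<..1}"
  shows "deriv curvature t = profile t * (1 - (spiral_w t)\<^sup>2) / spiral_speed t"
proof -
  define q R where "q = spiral_q t" "R = sqrt (1 + (spiral_q t)\<^sup>2)"
  have t: "t > 0" "\<not> t - 1 > 0" using assms by auto
  have q: "q > 0" "R > 0" "q\<^sup>2 - 1 \<noteq> 0"
    using spiral_q_le[OF t(1)] profile_denominator_neg[OF t(1)] t(2)
    by (simp_all add: q_R_def profile_denominator_def add_pos_nonneg)
  have D: "profile_denominator t = q\<^sup>2 - 1" using t(2) by (simp add: profile_denominator_def q_R_def)
  have "profile t * (1 - (spiral_w t)\<^sup>2) / spiral_speed t
      = q * (deriv curvature t * R * inverse (q\<^sup>2 - 1)) * (1 - (- inverse q)\<^sup>2) / (R / q)"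
    unfolding profile_def D spiral_w_q[OF t(1)] spiral_speed_q[OF t(1)] by (simp add: q_R_def)
  also have "1 - (- inverse q)\<^sup>2 = (q\<^sup>2 - 1) / q\<^sup>2"
    using q by (simp add: field_simps power2_eq_square)
  also have "q * (deriv curvature t * R * inverse (q\<^sup>2 - 1)) * ((q\<^sup>2 - 1) / q\<^sup>2) / (R / q) = deriv curvature t"
    using q by (simp add: power2_eq_square)
  finally show ?thesis by simp
qed

section \<open>The bivector equation as a scalar equation\<close>

lemma christoffel_plane_metric: "christoffel plane_metric k i j p = 0"
  unfolding christoffel_def plane_metric_def by (simp add: partial_const)

lemma glength_plane_metric: "glength plane_metric p u = norm u"
  by (simp add: glength_def ginner_def plane_metric_def norm_eq_sqrt_inner)

lemma plane_spiral_eq: "plane_spiral t = vector [spiral_x t, spiral_y t]"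
  by (simp add: plane_spiral_def spiral_x_def spiral_y_def)

lemma has_vector_derivative_2:
  assumes "(x has_real_derivative x') (at t within A)" "(y has_real_derivative y') (at t within A)"
  shows "((\<lambda>t. vector [x t, y t] :: real^2) has_vector_derivative vector [x', y']) (at t within A)"
proof (rule has_vector_derivative_vecI)
  fix i :: 2
  show "((\<lambda>s. (vector [x s, y s] :: real^2) $ i) has_real_derivative vector [x', y'] $ i) (at t within A)"
    using exhaust_2[of i] assms by auto
qed

lemma tensor_M_spiral:
  assumes "t > 0"
  shows "tensor_M (plane_spiral t) = vector [vector [M_diag t, M_off t], vector [M_off t, - M_diag t]]"
proof -
  have n: "norm (plane_spiral t) = t"
    using assms spiral_position_sq[of t]
    by (simp add: plane_spiral_eq norm_eq_sqrt_inner inner_vec_def sum_2 flip: power2_eq_square)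
  show ?thesis
    unfolding matrix_2_eq tensor_M_def symprod_def plane_dr_def plane_dphi_def n unfolding plane_spiral_eq
    using assms by (simp add: M_diag_def M_off_def field_simps power2_eq_square)
qed

text \<open>Every bivector of the plane is a multiple of the constant matrix \<open>J\<close>, and
  the Cartesian Christoffel symbols vanish, so the covariant derivative differentiates the
  coefficient alone. On the left this coefficient is the signed curvature.\<close>

lemma spiral_profile_iff:
  "spiral_profile k \<longleftrightarrow> O_infty k \<and>
     (\<forall>t\<in>{0<..1}. deriv curvature t = k t * (1 - (spiral_w t)\<^sup>2) / spiral_speed t)"
proof -
  define I :: "real set" where "I = {0<..1}"
  have pI: "perfect_on I"
    by (rule perfect_on_interval[of _ 1 "1/2"]) (auto simp: I_def is_interval_1)
  have pos: "t > 0" if "t \<in> I" for t using that by (simp add: I_def)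
  define v b J where "v = velocity I plane_spiral" "b = cov_deriv plane_metric I plane_spiral v"
    "J = (vector [vector [0, 1], vector [-1, 0]] :: real^2^2)"
  have v: "v t = vector [spiral_x' t, spiral_y' t]" if "t \<in> I" for t
    unfolding v_b_J_def plane_spiral_eq[abs_def]
    using that pos by (intro velocity_eqI[OF pI] has_vector_derivative_2 spiral_derivs) auto
  have b: "b t = vector [spiral_x'' t, spiral_y'' t]" if "t \<in> I" for t
  proof -
    have "vector_derivative v (at t within I) = vector [spiral_x'' t, spiral_y'' t]"
      by (rule vector_derivative_cong_on[OF pI that has_vector_derivative_2[OF spiral_derivs(4,5)]])
        (use that pos v in auto)
    then show ?thesis unfolding v_b_J_def cov_deriv_def christoffel_plane_metric
      by (simp add: vec_eq_iff)
  qed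
  have len: "glength plane_metric (plane_spiral t) (v t) = spiral_speed t" if "t \<in> I" for t
    using spiral_velocity_sq[of t] less_imp_le[OF spiral_speed_pos[of t]] unfolding glength_plane_metric v[OF that]
    by (simp add: norm_eq_sqrt_inner inner_vec_def sum_2 flip: power2_eq_square)
  define B where "B = (\<lambda>s. (1 / glength plane_metric (plane_spiral s) (v s) ^ 3) *\<^sub>R wedge (v s) (b s))"
  have B: "curvature t *\<^sub>R J = B t" if "t \<in> I" for t
  proof -
    have "wedge (v t) (b t) = (curvature t * spiral_speed t ^ 3) *\<^sub>R J"
      unfolding spiral_wedge[symmetric] wedge_def v[OF that] b[OF that] matrix_2_eq
      by (simp add: v_b_J_def)
    moreover have "spiral_speed t ^ 3 \<noteq> 0" by simp
    ultimately show ?thesis unfolding B_def len[OF that] by simp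
  qed
  have lhs: "cov_deriv_biv plane_metric I plane_spiral B t = deriv curvature t *\<^sub>R J" if "t \<in> I" for t
  proof -
    have "((\<lambda>t. curvature t *\<^sub>R J) has_vector_derivative deriv curvature t *\<^sub>R J) (at t within I)"
      using has_vector_derivative_scaleR[OF curvature_deriv[OF pos[OF that]] has_vector_derivative_const] by simp
    from vector_derivative_cong_on[OF pI that this B]
    show ?thesis unfolding cov_deriv_biv_def christoffel_plane_metric by (simp add: vec_eq_iff)
  qed
  have rhs: "(k t / glength plane_metric (plane_spiral t) (v t)) *\<^sub>R
      wedge (v t) (hat plane_metric tensor_M (plane_spiral t) (v t)) = (k t * (1 - (spiral_w t)\<^sup>2) / spiral_speed t) *\<^sub>R J"
    if "t \<in> I" for t
  proof -
    have "wedge (v t) (hat plane_metric tensor_M (plane_spiral t) (v t)) = (1 - (spiral_w t)\<^sup>2) *\<^sub>R J"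
      unfolding spiral_wedge_M[OF pos[OF that], symmetric] hat_def plane_metric_def matrix_inv_mat_1
        matrix_vector_mul_lid tensor_M_spiral[OF pos[OF that]] v[OF that] matrix_2_eq
      by (simp add: wedge_def v_b_J_def matrix_vector_mult_def sum_2 algebra_simps)
    then show ?thesis by (simp add: len[OF that])
  qed
  have "J $ 1 $ 2 = 1" by (simp add: v_b_J_def)
  then have "J \<noteq> 0" by auto
  then have "cov_deriv_biv plane_metric I plane_spiral B t = (k t / glength plane_metric (plane_spiral t) (v t)) *\<^sub>R
      wedge (v t) (hat plane_metric tensor_M (plane_spiral t) (v t)) \<longleftrightarrow>
      deriv curvature t = k t * (1 - (spiral_w t)\<^sup>2) / spiral_speed t" if "t \<in> I" for t
    unfolding lhs[OF that] rhs[OF that] by simp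
  then show ?thesis
    unfolding spiral_profile_def Let_def I_def[symmetric] v_b_J_def(1,2)[symmetric] B_def[symmetric]
    by blast
qed

lemma spiral_profile_exists: "\<exists>k. spiral_profile k"
proof
  show "spiral_profile profile"
    unfolding spiral_profile_iff using flat_imp_O_infty[OF profile_flat] profile_equation by blast
qed

section \<open>The spiraling conformal geodesic\<close>

text \<open>\<open>\<tau>\<close> inverts the arc length \<open>L\<close> measured from parameter 1
  towards the origin. The speed is at least 1/t, so \<open>L\<close> dominates \<open>- ln t\<close>
  and takes every nonnegative value on \<open>(0, 1]\<close>.\<close>

lemma spiral_reparametrization:
  obtains \<tau> where "bij_betw \<tau> {0..} {0<..1}" "strict_antimono_on {0..} \<tau>"
    "\<And>s. s \<ge> 0 \<Longrightarrow> (\<tau> has_real_derivative - inverse (spiral_speed (\<tau> s))) (at s)"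
proof -
  have "isCont spiral_speed t" if "t > 0" for t
  proof -
    obtain d where "\<forall>t\<in>{0<..}. (spiral_speed has_real_derivative d t) (at t within {0<..})"
      by (rule tower_SucE[OF smooth_spiral(4)[of "Suc 0"]])
    then have "(spiral_speed has_real_derivative d t) (at t within {0<..})" using that by auto
    then have "(spiral_speed has_real_derivative d t) (at t)"
      using that by (simp add: at_within_open[of t "{0<..}"])
    then show ?thesis by (rule DERIV_isCont)
  qed
  then have "\<exists>F. \<forall>t. ereal 0 < ereal t \<longrightarrow> ereal t < \<infinity> \<longrightarrow> (F has_vector_derivative spiral_speed t) (at t)"
    by (intro einterval_antiderivative) auto
  then obtain F where F: "\<And>t. t > 0 \<Longrightarrow> (F has_real_derivative spiral_speed t) (at t)"
    by (auto simp: has_real_derivative_iff_has_vector_derivative)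
  define L where "L = (\<lambda>t. F 1 - F t)"
  have L': "(L has_real_derivative - spiral_speed t) (at t)" if "t > 0" for t
    using DERIV_diff[OF DERIV_const F[OF that], of "F 1"] by (simp add: L_def)
  have L1: "L 1 = 0" by (simp add: L_def)
  have anti: "L t < L s" if "0 < s" "s < t" for s t
  proof (rule DERIV_neg_imp_decreasing[OF that(2)])
    fix x assume "s \<le> x" "x \<le> t"
    then show "\<exists>y. (L has_real_derivative y) (at x) \<and> y < 0"
      using L'[of x] that by (intro exI[of _ "- spiral_speed x"]) auto
  qed
  then have inj: "inj_on L {0<..}" by (metis greaterThan_iff less_irrefl linorder_inj_onI')
  have ln: "- ln t \<le> L t" if "0 < t" "t \<le> 1" for t
  proof -
    have "L 1 + ln 1 \<le> L t + ln t"
    proof (rule DERIV_nonpos_imp_nonincreasing[OF that(2)])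
      fix x assume x: "t \<le> x" "x \<le> 1"
      then have "x > 0" using that by simp
      have "1 / x \<le> exp (1 / x) / x" using \<open>x > 0\<close> by (intro divide_right_mono) auto
      also have "\<dots> = \<bar>spiral_w x\<bar>" using \<open>x > 0\<close> by (simp add: spiral_w_def)
      also have "\<dots> \<le> spiral_speed x" unfolding spiral_speed_def by (rule real_le_rsqrt) simp
      finally have "1 / x \<le> spiral_speed x" .
      then show "\<exists>y. ((\<lambda>t. L t + ln t) has_real_derivative y) (at x) \<and> y \<le> 0"
        using DERIV_add[OF L'[OF \<open>x > 0\<close>] DERIV_ln_divide[OF \<open>x > 0\<close>]]
        by (intro exI[of _ "- spiral_speed x + 1 / x"]) auto
    qed
    then show ?thesis by (simp add: L1)
  qed
  have img: "L ` {0<..1} = {0..}"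
  proof
    show "L ` {0<..1} \<subseteq> {0..}"
    proof (rule image_subsetI)
      fix t :: real assume "t \<in> {0<..1}"
      then show "L t \<in> {0..}" using anti[of t 1] L1 by (cases "t = 1") auto
    qed
    show "{0..} \<subseteq> L ` {0<..1}"
    proof
      fix s :: real assume "s \<in> {0..}"
      then have s: "s \<ge> 0" "exp (- s) \<le> 1" by auto
      \<comment> \<open>The logarithmic bound gives \<open>s \<le> L (exp (- s))\<close>, and
        \<open>L 1 = 0 \<le> s\<close>; hence this interval brackets a preimage.\<close>
      have "\<exists>t\<ge>exp (- s). t \<le> 1 \<and> L t = s"
      proof (rule IVT2)
        show "s \<le> L (exp (- s))" using ln[of "exp (- s)"] s by simp
        show "\<forall>x. exp (- s) \<le> x \<and> x \<le> 1 \<longrightarrow> isCont L x"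
        proof (intro allI impI)
          fix x assume "exp (- s) \<le> x \<and> x \<le> 1"
          then have "x > 0" using exp_gt_zero[of "- s"] by linarith
          from L'[OF this] show "isCont L x" by (rule DERIV_isCont)
        qed
      qed (use s L1 in auto)
      then obtain t where t: "t \<ge> exp (- s)" "t \<le> 1" "L t = s" by blast
      then have "t > 0" using exp_gt_zero[of "- s"] by linarith
      with t show "s \<in> L ` {0<..1}" by auto
    qed
  qed
  \<comment> \<open>Inverting \<open>L\<close> on all of \<open>{0<..}\<close>, beyond parameter 1,
    makes the derivative of \<open>\<tau>\<close> two-sided even at \<open>s = 0\<close>.\<close>
  define \<tau> where "\<tau> = inv_into {0<..} L"
  have \<tau>L: "\<tau> (L t) = t" if "t > 0" for t
    unfolding \<tau>_def using that by (intro inv_into_f_f[OF inj]) auto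
  have bij: "bij_betw \<tau> {0..} {0<..1}"
    unfolding \<tau>_def by (rule bij_betw_inv_into_subset[OF inj_on_imp_bij_betw[OF inj] _ img]) auto
  have L\<tau>: "L (\<tau> s) = s" "\<tau> s > 0" if "s \<ge> 0" for s
  proof -
    from that img obtain t where "t \<in> {0<..1}" "s = L t" by (metis atLeast_iff imageE)
    with \<tau>L show "L (\<tau> s) = s" "\<tau> s > 0" by auto
  qed
  have "strict_antimono_on {0..} \<tau>"
  proof (rule monotone_onI)
    fix r s :: real assume rs: "r \<in> {0..}" "s \<in> {0..}" "r < s"
    show "\<tau> s < \<tau> r"
    proof (rule ccontr)
      assume "\<not> \<tau> s < \<tau> r"
      then have "L (\<tau> s) \<le> L (\<tau> r)"
        using anti[of "\<tau> r" "\<tau> s"] L\<tau>[of r] rs by (cases "\<tau> r = \<tau> s") auto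
      with L\<tau> rs show False by auto
    qed
  qed
  moreover have "(\<tau> has_real_derivative - inverse (spiral_speed (\<tau> s))) (at s)" if "s \<ge> 0" for s
  proof -
    have "(\<tau> has_derivative (*) (inverse (- spiral_speed (\<tau> s)))) (at (L (\<tau> s)))"
    proof (rule has_derivative_inverse_strong[of "{0<..}" "\<tau> s" L])
      show "continuous_on {0<..} L"
        using L' DERIV_isCont by (intro continuous_at_imp_continuous_on) auto
      show "(L has_derivative (*) (- spiral_speed (\<tau> s))) (at (\<tau> s))"
        using L'[OF L\<tau>(2)[OF that]] by (simp add: has_field_derivative_def)
    qed (use \<tau>L L\<tau>[OF that] in \<open>auto simp: fun_eq_iff\<close>)
    then show ?thesis using L\<tau>(1)[OF that] by (simp add: has_field_derivative_def)
  qed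
  ultimately show ?thesis using that bij by blast
qed

text \<open>Serves to differentiate an identity that holds only on \<open>A\<close>; the relations
  between \<open>u\<close>, \<open>a\<close> and \<open>j\<close> in \<open>planar_equation\<close>
  arise in this way.\<close>

lemma DERIV_unique_on:
  assumes "perfect_on A" "s \<in> A" "(f has_real_derivative d) (at s within A)"
    "(g has_real_derivative e) (at s within A)" "\<And>t. t \<in> A \<Longrightarrow> f t = g t"
  shows "d = e"
proof (rule vector_derivative_unique_within)
  show "at s within A \<noteq> bot" using assms by (auto simp: perfect_on_def)
  show "(g has_vector_derivative e) (at s within A)"
    using assms(4) by (simp add: has_real_derivative_iff_has_vector_derivative)
  show "(g has_vector_derivative d) (at s within A)"
    using has_real_derivative_cong_on[OF assms(5,2,3)]
    by (simp add: has_real_derivative_iff_has_vector_derivative)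
qed

lemma has_vector_derivative_3:
  assumes "(x has_real_derivative x') (at t within A)" "(y has_real_derivative y') (at t within A)"
  shows "((\<lambda>t. vector [x t, y t, 0] :: real^3) has_vector_derivative vector [x', y', 0]) (at t within A)"
proof (rule has_vector_derivative_vecI)
  fix i :: 3
  show "((\<lambda>s. (vector [x s, y s, 0] :: real^3) $ i) has_real_derivative vector [x', y', 0] $ i) (at t within A)"
    using exhaust_3[of i] assms by auto
qed

section \<open>The geodesic equation for an arbitrary profile\<close>

context
  fixes \<tau> :: "real \<Rightarrow> real" and k h :: "real \<Rightarrow> real"
  assumes bij: "bij_betw \<tau> {0..} {0<..1}" and anti: "strict_antimono_on {0..} \<tau>"
    and \<tau>': "\<And>s. s \<ge> 0 \<Longrightarrow> (\<tau> has_real_derivative - inverse (spiral_speed (\<tau> s))) (at s)"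
    and k: "spiral_profile k" and h: "\<And>r. r > 0 \<Longrightarrow> h r = - k r / 2"
begin

lemma \<tau>_range: "s \<in> {0..} \<Longrightarrow> \<tau> s \<in> {0<..1}"
  using bij by (auto simp: bij_betw_def)

lemma perfect: "perfect_on {0::real..}" "perfect_on {0::real<..}"
  by (rule perfect_on_interval[of _ 1 2]; simp add: is_interval_1)+

lemma flat_profile_h: "flat_profile h"
proof
  fix m
  have "O_infty k" using k unfolding spiral_profile_iff by blast
  from tower_flat_mult_moderate[OF O_infty_imp_flat[OF this] moderate.tower_const]
  have "tower flat {0<..} m (\<lambda>r. k r * (- 1 / 2))" .
  then show "tower flat {0<..} m h" by (rule tower_flat_cong) (simp add: h)
qed

text \<open>Bootstrapping: the right-hand side of the differential equation for
  \<open>\<tau>\<close> is as smooth as \<open>\<tau>\<close> itself.\<close>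

lemma smooth_\<tau>: "smooth_upto {0..} m \<tau>"
proof (induction m)
  case (Suc m)
  show ?case
  proof (rule tower_SucI)
    have "smooth_upto {0<..} m (\<lambda>t. - inverse (spiral_speed t))"
      by (intro smooth.tower_minus smooth.tower_inverse smooth_spiral) auto
    from smooth_compose[OF this Suc] show "smooth_upto {0..} m (\<lambda>s. - inverse (spiral_speed (\<tau> s)))"
      using \<tau>_range by fastforce
  qed (use \<tau>' in \<open>auto intro: has_field_derivative_at_within\<close>)
qed auto

lemma curve_eq: "(space_spiral \<circ> \<tau>) s = vector [spiral_x (\<tau> s), spiral_y (\<tau> s), 0]"
  by (simp add: space_spiral_def spiral_x_def spiral_y_def)

lemma smooth_xy: "smooth_upto {0..} m (\<lambda>s. spiral_x (\<tau> s))" "smooth_upto {0..} m (\<lambda>s. spiral_y (\<tau> s))"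
  using \<tau>_range by (intro smooth_compose[OF smooth_spiral(1) smooth_\<tau>] smooth_compose[OF smooth_spiral(2) smooth_\<tau>]; fastforce)+

lemma smooth_curve: "smooth_curve_on {0..} (space_spiral \<circ> \<tau>)" "smooth_curve_on {0<..} (space_spiral \<circ> \<tau>)"
proof -
  have *: "smooth_upto {0..} m (\<lambda>s. (space_spiral \<circ> \<tau>) s $ i)" for m i
    unfolding curve_eq using exhaust_3[of i] smooth_xy[of m] smooth.tower_const by auto
  show "smooth_curve_on {0..} (space_spiral \<circ> \<tau>)"
    by (rule smooth_curve_onI[OF perfect(1) *])
  show "smooth_curve_on {0<..} (space_spiral \<circ> \<tau>)"
    by (rule smooth_curve_onI[OF perfect(2) tower_subset[OF *]]) auto
qed

text \<open>The equation is checked in terms of the planar components \<open>u\<close>, \<open>a\<close> and \<open>j\<close> of the first three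
  derivatives with respect to proper time: since \<open>u\<close> is a unit vector, \<open>j\<close> is determined by
  \<open>u \<bullet> j = - \<bar>a\<bar>\<^sup>2\<close> and by \<open>u \<and> j\<close>, the derivative of the curvature \<open>u \<and> a\<close>.\<close>

lemma planar_equation:
  obtains u1 u2 a1 a2 j1 j2 where
    "\<And>s. s \<ge> 0 \<Longrightarrow> ((\<lambda>s. spiral_x (\<tau> s)) has_real_derivative u1 s) (at s within {0..})"
    "\<And>s. s \<ge> 0 \<Longrightarrow> ((\<lambda>s. spiral_y (\<tau> s)) has_real_derivative u2 s) (at s within {0..})"
    "\<And>s. s \<ge> 0 \<Longrightarrow> (u1 has_real_derivative a1 s) (at s within {0..})"
    "\<And>s. s \<ge> 0 \<Longrightarrow> (u2 has_real_derivative a2 s) (at s within {0..})"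
    "\<And>s. s \<ge> 0 \<Longrightarrow> (a1 has_real_derivative j1 s) (at s within {0..})"
    "\<And>s. s \<ge> 0 \<Longrightarrow> (a2 has_real_derivative j2 s) (at s within {0..})"
    "\<And>s. s \<ge> 0 \<Longrightarrow> u1 s * u1 s + u2 s * u2 s = 1"
    "\<And>s. s \<ge> 0 \<Longrightarrow> u1 s * j1 s + u2 s * j2 s = - (a1 s * a1 s + a2 s * a2 s)"
    "\<And>s. s \<ge> 0 \<Longrightarrow> u1 s * j2 s - j1 s * u2 s = k (\<tau> s) * (u1 s * (M_off (\<tau> s) * u1 s - M_diag (\<tau> s) * u2 s)
        - (M_diag (\<tau> s) * u1 s + M_off (\<tau> s) * u2 s) * u2 s)"
proof -
  define I where "I = {0::real..}"
  have pI: "perfect_on I" using perfect by (simp add: I_def)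
  define \<sigma> where "\<sigma> = (\<lambda>s. inverse (spiral_speed (\<tau> s)))"
  have pos: "\<tau> s > 0" if "s \<in> I" for s using \<tau>_range that by (simp add: I_def)
  have \<tau>: "(\<tau> has_real_derivative - \<sigma> s) (at s within I)" if "s \<in> I" for s
    using \<tau>'[of s] that by (simp add: I_def \<sigma>_def has_field_derivative_at_within)
  have comp: "((\<lambda>s. f (\<tau> s)) has_real_derivative d * - \<sigma> s) (at s within I)"
    if "s \<in> I" "(f has_real_derivative d) (at (\<tau> s))" for f d s
    using DERIV_chain2[OF that(2) \<tau>[OF that(1)]] .
  have "smooth_upto {0<..} (Suc 0) (\<lambda>t. inverse (spiral_speed t))"
    by (intro smooth.tower_inverse smooth_spiral) auto
  from smooth_compose[OF this smooth_\<tau>] have "smooth_upto I (Suc 0) \<sigma>"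
    using \<tau>_range unfolding \<sigma>_def I_def by fastforce
  then obtain \<sigma>' where \<sigma>': "\<forall>s\<in>I. (\<sigma> has_real_derivative \<sigma>' s) (at s within I)" by (rule tower_SucE)
  have jet: "\<exists>u a j. (\<forall>s\<in>I. (f has_real_derivative u s) (at s within I)) \<and>
      (\<forall>s\<in>I. (u has_real_derivative a s) (at s within I)) \<and> (\<forall>s\<in>I. (a has_real_derivative j s) (at s within I))"
    if "smooth_upto I 3 f" for f
    using that by (auto simp: numeral_3_eq_3)
  obtain u1 a1 j1 where x: "\<forall>s\<in>I. ((\<lambda>s. spiral_x (\<tau> s)) has_real_derivative u1 s) (at s within I)"
    "\<forall>s\<in>I. (u1 has_real_derivative a1 s) (at s within I)" "\<forall>s\<in>I. (a1 has_real_derivative j1 s) (at s within I)"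
    using jet smooth_xy(1) unfolding I_def by blast
  obtain u2 a2 j2 where y: "\<forall>s\<in>I. ((\<lambda>s. spiral_y (\<tau> s)) has_real_derivative u2 s) (at s within I)"
    "\<forall>s\<in>I. (u2 has_real_derivative a2 s) (at s within I)" "\<forall>s\<in>I. (a2 has_real_derivative j2 s) (at s within I)"
    using jet smooth_xy(2) unfolding I_def by blast
  note x = x[rule_format] and y = y[rule_format]
  \<comment> \<open>The derivatives obtained from abstract smoothness are identified with those
    given by the chain rule.\<close>
  have u: "u1 s = spiral_x' (\<tau> s) * - \<sigma> s" "u2 s = spiral_y' (\<tau> s) * - \<sigma> s" if s: "s \<in> I" for s
    using DERIV_unique_on[OF pI s x(1)[OF s] comp[OF s spiral_derivs(1)[OF pos[OF s]]]]
      DERIV_unique_on[OF pI s y(1)[OF s] comp[OF s spiral_derivs(2)[OF pos[OF s]]]] by simp_all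
  have a: "a1 s = spiral_x'' (\<tau> s) * (\<sigma> s)\<^sup>2 - spiral_x' (\<tau> s) * \<sigma>' s"
    "a2 s = spiral_y'' (\<tau> s) * (\<sigma> s)\<^sup>2 - spiral_y' (\<tau> s) * \<sigma>' s" if s: "s \<in> I" for s
    using DERIV_unique_on[OF pI s x(2)[OF s] DERIV_mult[OF comp[OF s spiral_derivs(4)[OF pos[OF s]]]
          DERIV_minus[OF \<sigma>'[rule_format, OF s]]]]
      DERIV_unique_on[OF pI s y(2)[OF s] DERIV_mult[OF comp[OF s spiral_derivs(5)[OF pos[OF s]]]
          DERIV_minus[OF \<sigma>'[rule_format, OF s]]]] u
    by (simp_all add: power2_eq_square algebra_simps)
  have \<sigma>: "\<sigma> s * spiral_speed (\<tau> s) = 1" for s by (simp add: \<sigma>_def)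
  have unit: "u1 s * u1 s + u2 s * u2 s = 1" if s: "s \<in> I" for s
  proof -
    have "u1 s * u1 s + u2 s * u2 s = ((spiral_x' (\<tau> s))\<^sup>2 + (spiral_y' (\<tau> s))\<^sup>2) * (\<sigma> s)\<^sup>2"
      unfolding u[OF s] by (simp add: power2_eq_square algebra_simps)
    also have "\<dots> = (\<sigma> s * spiral_speed (\<tau> s))\<^sup>2"
      unfolding spiral_velocity_sq by (simp add: power_mult_distrib)
    finally show ?thesis by (simp add: \<sigma>)
  qed
  \<comment> \<open>Differentiating \<open>u \<bullet> u = 1\<close> gives orthogonality of
    \<open>u\<close> and \<open>a\<close>; differentiating once more gives the tangential component
    of \<open>j\<close>.\<close>
  have ua: "u1 s * a1 s + u2 s * a2 s = 0" if s: "s \<in> I" for s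
    using DERIV_unique_on[OF pI s DERIV_add[OF DERIV_mult[OF x(2)[OF s] x(2)[OF s]] DERIV_mult[OF y(2)[OF s] y(2)[OF s]]]
        DERIV_const[of 1]] unit by (simp add: algebra_simps)
  have uj: "u1 s * j1 s + u2 s * j2 s = - (a1 s * a1 s + a2 s * a2 s)" if s: "s \<in> I" for s
    using DERIV_unique_on[OF pI s DERIV_add[OF DERIV_mult[OF x(2)[OF s] x(3)[OF s]] DERIV_mult[OF y(2)[OF s] y(3)[OF s]]]
        DERIV_const[of 0]] ua by (simp add: algebra_simps)
  \<comment> \<open>The terms with \<open>\<sigma>'\<close> are parallel to \<open>u\<close> and
    cancel. The minus sign reflects the reversed direction of travel.\<close>
  have wa: "u1 s * a2 s - a1 s * u2 s = - curvature (\<tau> s)" if s: "s \<in> I" for s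
  proof -
    have "u1 s * a2 s - a1 s * u2 s
        = - ((spiral_x' (\<tau> s) * spiral_y'' (\<tau> s) - spiral_x'' (\<tau> s) * spiral_y' (\<tau> s)) * \<sigma> s ^ 3)"
      unfolding u[OF s] a[OF s] by (simp add: power2_eq_square power3_eq_cube algebra_simps)
    also have "\<dots> = - curvature (\<tau> s) * (\<sigma> s * spiral_speed (\<tau> s)) ^ 3"
      unfolding spiral_wedge by (simp add: power_mult_distrib)
    finally show ?thesis by (simp add: \<sigma>)
  qed
  \<comment> \<open>The derivative of \<open>u \<and> a\<close> is \<open>u \<and> j\<close> because
    \<open>a \<and> a = 0\<close>. The sign of the reversed curvature and that of the derivative of
    \<open>\<tau>\<close> compensate each other.\<close>
  have wj: "u1 s * j2 s - j1 s * u2 s = deriv curvature (\<tau> s) * \<sigma> s" if s: "s \<in> I" for s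
    using DERIV_unique_on[OF pI s DERIV_diff[OF DERIV_mult[OF x(2)[OF s] y(3)[OF s]] DERIV_mult[OF x(3)[OF s] y(2)[OF s]]]
        DERIV_minus[OF comp[OF s curvature_deriv[OF pos[OF s]]]]] wa
    by (simp add: algebra_simps)
  have "u1 s * j2 s - j1 s * u2 s = k (\<tau> s) * (u1 s * (M_off (\<tau> s) * u1 s - M_diag (\<tau> s) * u2 s)
      - (M_diag (\<tau> s) * u1 s + M_off (\<tau> s) * u2 s) * u2 s)" if s: "s \<in> I" for s
  proof -
    have "deriv curvature (\<tau> s) = k (\<tau> s) * (1 - (spiral_w (\<tau> s))\<^sup>2) / spiral_speed (\<tau> s)"
      using k \<tau>_range[of s] s unfolding spiral_profile_iff I_def by blast
    then have "deriv curvature (\<tau> s) * \<sigma> s = k (\<tau> s) * ((1 - (spiral_w (\<tau> s))\<^sup>2) * (\<sigma> s)\<^sup>2)"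
      by (simp add: \<sigma>_def divide_inverse power2_eq_square)
    also have "(1 - (spiral_w (\<tau> s))\<^sup>2) * (\<sigma> s)\<^sup>2 = u1 s * (M_off (\<tau> s) * u1 s - M_diag (\<tau> s) * u2 s)
      - (M_diag (\<tau> s) * u1 s + M_off (\<tau> s) * u2 s) * u2 s"
      unfolding spiral_wedge_M[OF pos[OF s], symmetric] u[OF s] by (simp add: power2_eq_square algebra_simps)
    finally show ?thesis using wj[OF s] by simp
  qed
  then show ?thesis
    using that[of u1 u2 a1 a2 j1 j2] x y unit uj unfolding I_def by simp
qed

lemma schouten_curve:
  assumes "t > 0"
  shows "schouten (cyl_metric h) (vector [spiral_x t, spiral_y t, 0]) =
    block (k t * M_diag t) (k t * M_off t) (- (k t * M_diag t)) 0"
proof -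
  interpret flat_profile h by (rule flat_profile_h)
  let ?p = "vector [spiral_x t, spiral_y t, 0] :: real^3"
  have "cyl_radius ?p = t"
    using assms spiral_position_sq[of t] by (simp add: cyl_radius_def)
  then have "- 2 * cyl_diag h ?p = k t * M_diag t" "- 2 * cyl_off h ?p = k t * M_off t"
    using assms h[OF assms] by (simp_all add: cyl_diag_def cyl_off_def radial_def M_diag_def M_off_def)
  moreover from this have "2 * cyl_diag h ?p = - (k t * M_diag t)" by linarith
  moreover have "?p $ 3 = 0" by simp
  ultimately show ?thesis using cyl_metric_plane(3)[of ?p] by simp
qed

text \<open>The geodesic equation is stated on the closed half-line, the notion of a spiral on the
  open one; the velocity on the latter is inherited by restriction.\<close>

lemma conformal_geodesic_curve:
  "conformal_geodesic (cyl_domain h) (cyl_metric h) {0..} (space_spiral \<circ> \<tau>)"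
  "proper_time_parametrized (cyl_metric h) {0<..} (space_spiral \<circ> \<tau>)"
proof -
  interpret flat_profile h by (rule flat_profile_h)
  obtain u1 u2 a1 a2 j1 j2 where x: "\<And>s. s \<ge> 0 \<Longrightarrow> ((\<lambda>s. spiral_x (\<tau> s)) has_real_derivative u1 s) (at s within {0..})"
    and y: "\<And>s. s \<ge> 0 \<Longrightarrow> ((\<lambda>s. spiral_y (\<tau> s)) has_real_derivative u2 s) (at s within {0..})"
    and u: "\<And>s. s \<ge> 0 \<Longrightarrow> (u1 has_real_derivative a1 s) (at s within {0..})"
      "\<And>s. s \<ge> 0 \<Longrightarrow> (u2 has_real_derivative a2 s) (at s within {0..})"
    and a: "\<And>s. s \<ge> 0 \<Longrightarrow> (a1 has_real_derivative j1 s) (at s within {0..})"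
      "\<And>s. s \<ge> 0 \<Longrightarrow> (a2 has_real_derivative j2 s) (at s within {0..})"
    and unit: "\<And>s. s \<ge> 0 \<Longrightarrow> u1 s * u1 s + u2 s * u2 s = 1"
    and uj: "\<And>s. s \<ge> 0 \<Longrightarrow> u1 s * j1 s + u2 s * j2 s = - (a1 s * a1 s + a2 s * a2 s)"
    and wj: "\<And>s. s \<ge> 0 \<Longrightarrow> u1 s * j2 s - j1 s * u2 s = k (\<tau> s) * (u1 s * (M_off (\<tau> s) * u1 s - M_diag (\<tau> s) * u2 s)
        - (M_diag (\<tau> s) * u1 s + M_off (\<tau> s) * u2 s) * u2 s)"
    by (rule planar_equation) blast
  let ?\<gamma> = "space_spiral \<circ> \<tau>" and ?g = "cyl_metric h"
  have plane: "?\<gamma> s $ 3 = 0" for s unfolding curve_eq by simp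
  have metric: "?g (?\<gamma> s) = mat 1" and chr: "christoffel ?g l i j (?\<gamma> s) = 0" for s l i j
    using cyl_metric_plane(1,2)[OF plane] by blast+
  have inner: "ginner ?g (?\<gamma> s) v w = v \<bullet> w" and length: "glength ?g (?\<gamma> s) v = norm v" for s v w
    unfolding glength_def ginner_def metric matrix_vector_mul_lid norm_eq_sqrt_inner by (rule refl)+
  have cov: "cov_deriv ?g A ?\<gamma> X s = vector_derivative X (at s within A)" for A X s
    unfolding cov_deriv_def chr by (simp add: vec_eq_iff)
  have D: "(?\<gamma> has_vector_derivative vector [u1 s, u2 s, 0]) (at s within {0..})" if "s \<ge> 0" for s
    unfolding curve_eq[abs_def] using has_vector_derivative_3[OF x[OF that] y[OF that]] .
  have vel: "velocity {0..} ?\<gamma> s = vector [u1 s, u2 s, 0]" if "s \<ge> 0" for s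
    by (rule velocity_eqI[OF perfect(1) _ D]) (use that in auto)
  have vel0: "velocity {0<..} ?\<gamma> s = vector [u1 s, u2 s, 0]" if "s > 0" for s
    by (rule velocity_eqI[OF perfect(2) _ has_vector_derivative_within_subset[OF D]]) (use that in auto)
  have acc: "acceleration ?g {0..} ?\<gamma> s = vector [a1 s, a2 s, 0]" if "s \<ge> 0" for s
    unfolding acceleration_def cov
    by (rule vector_derivative_cong_on[OF perfect(1) _ has_vector_derivative_3[OF u]]) (use that vel in auto)
  have jerk: "cov_deriv ?g {0..} ?\<gamma> (acceleration ?g {0..} ?\<gamma>) s = vector [j1 s, j2 s, 0]" if "s \<ge> 0" for s
    unfolding cov
    by (rule vector_derivative_cong_on[OF perfect(1) _ has_vector_derivative_3[OF a]]) (use that acc in auto)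
  have norm1: "norm (vector [u1 s, u2 s, 0] :: real^3) = 1" if "s \<ge> 0" for s
    using unit[OF that] by (simp add: norm_eq_sqrt_inner inner_vec_def sum_3)
  show pt0: "proper_time_parametrized ?g {0<..} ?\<gamma>"
    unfolding proper_time_parametrized_def length using smooth_curve vel0 norm1 by auto
  have pt: "proper_time_parametrized ?g {0..} ?\<gamma>"
    unfolding proper_time_parametrized_def length using smooth_curve vel norm1 by auto
  have eqn: "cov_deriv ?g {0..} ?\<gamma> (acceleration ?g {0..} ?\<gamma>) s =
      (- (glength ?g (?\<gamma> s) (acceleration ?g {0..} ?\<gamma> s))\<^sup>2
        - ginner ?g (?\<gamma> s) (velocity {0..} ?\<gamma> s) (hat ?g (schouten ?g) (?\<gamma> s) (velocity {0..} ?\<gamma> s)))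
       *\<^sub>R velocity {0..} ?\<gamma> s + hat ?g (schouten ?g) (?\<gamma> s) (velocity {0..} ?\<gamma> s)"
    if s: "s \<ge> 0" for s
  proof -
    define D E where "D = k (\<tau> s) * M_diag (\<tau> s)" "E = k (\<tau> s) * M_off (\<tau> s)"
    define l1 l2 where "l1 = D * u1 s + E * u2 s" "l2 = E * u1 s - D * u2 s"
    have "\<tau> s > 0" using \<tau>_range[of s] s by simp
    note sch = schouten_curve[OF this]
    have L: "hat ?g (schouten ?g) (?\<gamma> s) (vector [u1 s, u2 s, 0]) = vector [l1, l2, 0]"
      unfolding hat_def metric matrix_inv_mat_1 matrix_vector_mul_lid unfolding curve_eq sch
      by (simp add: vec_eq_iff forall_3 matrix_vector_mult_def sum_3 l1_l2_def D_E_def)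
    have "u1 s * j2 s - j1 s * u2 s = u1 s * l2 - l1 * u2 s"
      unfolding wj[OF s] by (simp add: l1_l2_def D_E_def algebra_simps)
    \<comment> \<open>A planar vector is determined by its inner product and its wedge with the unit
      vector \<open>u\<close>. Both sides have inner product \<open>- \<bar>a\<bar>\<^sup>2\<close>
      with \<open>u\<close>, and their wedges with \<open>u\<close> agree by the preceding
      equation.\<close>
    then have "j1 s = (- (a1 s * a1 s + a2 s * a2 s) - (u1 s * l1 + u2 s * l2)) * u1 s + l1"
      "j2 s = (- (a1 s * a1 s + a2 s * a2 s) - (u1 s * l1 + u2 s * l2)) * u2 s + l2"
      using unit[OF s] uj[OF s] by algebra+
    then show ?thesis
      unfolding jerk[OF s] acc[OF s] vel[OF s] L inner length
      by (simp add: vec_eq_iff forall_3 inner_vec_def sum_3 power2_norm_eq_inner)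
  qed
  show "conformal_geodesic (cyl_domain h) ?g {0..} ?\<gamma>"
    unfolding conformal_geodesic_def Let_def
    using riemannian_cyl_metric plane_subset_cyl_domain plane pt eqn by (auto simp: is_interval_1)
qed

text \<open>The distance from the origin at proper time \<open>s\<close> is \<open>\<tau> s\<close>,
  which decreases and takes all values in \<open>(0, 1]\<close>.\<close>

lemma spirals_curve: "spirals_to (cyl_metric h) (space_spiral \<circ> \<tau>) 0"
  unfolding spirals_to_def
proof (intro conjI allI impI)
  fix V :: "(real^3) set" assume V: "open V \<and> 0 \<in> V"
  then obtain e where e: "e > 0" "ball 0 e \<subseteq> V" using open_contains_ball by blast
  define t where "t = min 1 (e / 2)"
  have "t \<in> {0<..1}" using e by (auto simp: t_def)
  then obtain s0 where s0: "s0 \<ge> 0" "\<tau> s0 = t" using bij unfolding bij_betw_def by (metis atLeast_iff imageE)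
  \<comment> \<open>The threshold must be strictly positive while \<open>s0\<close> may be 0, hence
    the witness \<open>s0 + 1\<close>.\<close>
  show "\<exists>s0>0. \<forall>s>s0. (space_spiral \<circ> \<tau>) s \<in> V"
  proof (intro exI[of _ "s0 + 1"] conjI allI impI)
    fix s assume s: "s > s0 + 1"
    have "\<tau> s < t" using monotone_onD[OF anti, of s0 s] s s0 by auto
    have "\<tau> s > 0" using \<tau>_range[of s] s s0 by simp
    have "norm ((space_spiral \<circ> \<tau>) s) = \<tau> s"
      unfolding curve_eq using spiral_position_sq[of "\<tau> s"] \<open>\<tau> s > 0\<close>
      by (simp add: norm_eq_sqrt_inner inner_vec_def sum_3 flip: power2_eq_square)
    also have "\<dots> < e" using \<open>\<tau> s < t\<close> e(1) by (simp add: t_def)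
    finally have "(space_spiral \<circ> \<tau>) s \<in> ball 0 e" by (simp only: mem_ball_0)
    with e(2) show "(space_spiral \<circ> \<tau>) s \<in> V" by blast
  qed (use s0 in auto)
qed (rule conformal_geodesic_curve(2))

end

theorem proposition6:
  shows "(\<exists>k. spiral_profile k) \<and>
    (\<forall>k h. spiral_profile k \<and> (\<forall>r>0. h r = - k r / 2) \<longrightarrow>
       smooth_tensor_on UNIV (cyl_metric h) \<and>
       riemannian_metric_on (cyl_domain h) (cyl_metric h) \<and>
       {p. p$3 = 0} \<subseteq> cyl_domain h \<and>
       (\<exists>\<tau>::real \<Rightarrow> real. bij_betw \<tau> {0..} {0<..1} \<and> strict_antimono_on {0..} \<tau> \<and>
          conformal_geodesic (cyl_domain h) (cyl_metric h) {0..} (space_spiral \<circ> \<tau>) \<and>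
          spirals_to (cyl_metric h) (space_spiral \<circ> \<tau>) 0))"
proof (intro conjI allI impI spiral_profile_exists)
  fix k h assume *: "spiral_profile k \<and> (\<forall>r>0. h r = - k r / 2)"
  obtain \<tau> where \<tau>: "bij_betw \<tau> {0..} {0<..1}" "strict_antimono_on {0..} \<tau>"
    "\<And>s. s \<ge> 0 \<Longrightarrow> (\<tau> has_real_derivative - inverse (spiral_speed (\<tau> s))) (at s)"
    by (rule spiral_reparametrization) blast
  from * have k: "spiral_profile k" and h: "\<And>r. r > 0 \<Longrightarrow> h r = - k r / 2" by auto
  interpret flat_profile h by (rule flat_profile_h[OF \<tau> k h])
  show "smooth_tensor_on UNIV (cyl_metric h)" by (rule smooth_cyl_metric)
  show "riemannian_metric_on (cyl_domain h) (cyl_metric h)" by (rule riemannian_cyl_metric)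
  show "{p. p$3 = 0} \<subseteq> cyl_domain h" by (rule plane_subset_cyl_domain)
  show "\<exists>\<tau>::real \<Rightarrow> real. bij_betw \<tau> {0..} {0<..1} \<and> strict_antimono_on {0..} \<tau> \<and>
          conformal_geodesic (cyl_domain h) (cyl_metric h) {0..} (space_spiral \<circ> \<tau>) \<and>
          spirals_to (cyl_metric h) (space_spiral \<circ> \<tau>) 0"
    using \<tau>(1,2) conformal_geodesic_curve(1)[OF \<tau> k h] spirals_curve[OF \<tau> k h] by blast
qed

end
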